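(* Let $\rho>0$, $\beta>0$, $x_0>0$. For any positive integer $q$, the limit $$\lambda(\rho,\beta;q):=\lim_{n\to\infty}\frac1n\log\mathbb{E}[x_n^q]$$ (taken as $n\to\infty$ with $\beta=\frac12\sigma^2\tau n^2$ held fixed) exists and is given by $$\lambda(\rho,\beta;q)=\sup_{g\in\mathcal{G}_q}\left\{g(1)\log\rho+\beta\int_0^1(g(1)-g(x))^2\,dx-q\int_0^1 I\big(g'(x)/q\big)\,dx\right\},$$ where $I(x)=x\log x+(1-x)\log(1-x)$ and $$\mathcal{G}_q:=\left\{g:[0,1]\to[0,q]:\ g(0)=0,\ g\text{ is absolutely continuous and }0\le g'\le q\right\}.$$
   Context: Setup: for each $n\ge1$ the parameters $\sigma=\sigma_n>0$ and $\tau=\tau_n>0$ satisfy $\frac12\sigma_n^2\tau_n n^2=\beta$, with $\beta$ fixed. $W(t)$ is a standard Brownian motion started at $0$ at time $0$, $t_i=i\tau$, $W_i=W(t_i)$, and $a_i=1+\rho e^{\sigma W_i-\frac12\sigma^2t_i}$. The process is defined by $x_{i+1}=a_ix_i$ for $i\ge 0$, with deterministic initial value $x_0>0$; thus $x_n=x_0\prod_{i=0}^{n-1}a_i$, computed with parameters $\sigma_n,\tau_n$. Convention: $0\log 0=0$. The bound $0\le g'\le q$ is understood almost everywhere. *)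

theory Defs
  imports "HOL-Probability.Probability"
begin

locale standard_brownian_motion = prob_space M
  for M :: "'a measure" and W :: "real \<Rightarrow> 'a \<Rightarrow> real" +
  assumes random_variable_W: "\<And>t. 0 \<le> t \<Longrightarrow> random_variable borel (W t)"
    and AE_starts_at_0: "AE \<omega> in M. W 0 \<omega> = 0"
    and independent_increments:
      "\<And>(t :: nat \<Rightarrow> real) n. 0 \<le> t 0 \<Longrightarrow> mono t \<Longrightarrow>
         indep_vars (\<lambda>_. borel) (\<lambda>i \<omega>. W (t (Suc i)) \<omega> - W (t i) \<omega>) {..<n}"
    and normal_increments:
      "\<And>s t. 0 \<le> s \<Longrightarrow> s < t \<Longrightarrow>
         distributed M lborel (\<lambda>\<omega>. W t \<omega> - W s \<omega>) (normal_density 0 (sqrt (t - s)))"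
    and AE_continuous_paths: "AE \<omega> in M. continuous_on {0..} (\<lambda>t. W t \<omega>)"

definition growth_factor ::
    "(real \<Rightarrow> 'a \<Rightarrow> real) \<Rightarrow> real \<Rightarrow> real \<Rightarrow> real \<Rightarrow> nat \<Rightarrow> 'a \<Rightarrow> real" where
  "growth_factor W \<rho> \<sigma> \<tau> i \<omega> =
     1 + \<rho> * exp (\<sigma> * W (real i * \<tau>) \<omega> - 1/2 * \<sigma>\<^sup>2 * (real i * \<tau>))"

primrec growth_process ::
    "(real \<Rightarrow> 'a \<Rightarrow> real) \<Rightarrow> real \<Rightarrow> real \<Rightarrow> real \<Rightarrow> real \<Rightarrow> nat \<Rightarrow> 'a \<Rightarrow> real" where
  "growth_process W \<rho> \<sigma> \<tau> x0 0 \<omega> = x0"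
| "growth_process W \<rho> \<sigma> \<tau> x0 (Suc i) \<omega> =
     growth_factor W \<rho> \<sigma> \<tau> i \<omega> * growth_process W \<rho> \<sigma> \<tau> x0 i \<omega>"

text \<open>The convention \<open>0 log 0 = 0\<close> holds automatically, being a product with \<open>0\<close>.\<close>

definition entropy_function :: "real \<Rightarrow> real" where
  "entropy_function x = x * ln x + (1 - x) * ln (1 - x)"

text \<open>Absolute continuity of a function, in the classical \<open>\<epsilon>\<close>-\<open>\<delta>\<close> sense; not to be confused
  with the library's \<open>absolutely_continuous\<close>, which relates two measures.\<close>

definition absolutely_continuous_fun_on :: "real set \<Rightarrow> (real \<Rightarrow> real) \<Rightarrow> bool" where
  "absolutely_continuous_fun_on S f \<longleftrightarrow>
     (\<forall>\<epsilon>>0. \<exists>\<delta>>0. \<forall>D :: (real \<times> real) set.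
        finite D \<longrightarrow> (\<forall>(a, b)\<in>D. a < b \<and> {a..b} \<subseteq> S) \<longrightarrow>
        disjoint_family_on (\<lambda>(a, b). {a<..<b}) D \<longrightarrow>
        (\<Sum>(a, b)\<in>D. b - a) < \<delta> \<longrightarrow> (\<Sum>(a, b)\<in>D. \<bar>f b - f a\<bar>) < \<epsilon>)"

text \<open>Functions on \<open>[0,1]\<close> are represented by total functions on the reals. Their values outside
  \<open>[0,1]\<close> play no role: they can affect \<open>deriv g\<close> in \<open>[0,1]\<close> only at the two endpoints.\<close>

definition admissible_paths :: "nat \<Rightarrow> (real \<Rightarrow> real) set" where
  "admissible_paths q =
     {g. g \<in> {0..1} \<rightarrow> {0..real q} \<and> g 0 = 0 \<and> absolutely_continuous_fun_on {0..1} g \<and>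
         (AE x in lebesgue_on {0..1}. g differentiable (at x) \<and> 0 \<le> deriv g x \<and> deriv g x \<le> real q)}"

end

theory Submission
  imports Defs "HOL-Real_Asymp.Real_Asymp"
begin

text \<open>
  Put \<open>\<kappa> = \<beta> / n\<^sup>2 = 1/2 * \<sigma>\<^sup>2 * \<tau>\<close>. Expanding the \<open>q\<close>-th powers of the factors
  \<open>1 + \<rho> * exp (\<dots>)\<close> by the binomial theorem turns the moment into a sum over exponents
  \<open>k 0, \<dots>, k (n - 1)\<close> in \<open>{0..q}\<close> of Gaussian exponential moments. By summation by parts
  \<open>\<Sum>i<n. k i * W (i * \<tau>)\<close> is a combination of independent increments whose coefficients are the
  tail sums \<open>T m = k m + \<dots> + k (n - 1)\<close>, so up to a bounded factor (and \<open>x0 ^ q\<close>) the moment equals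
  the partition function
  \<open>Z = (\<Sum>k. (\<Prod>i<n. (q choose k i) * \<rho> ^ k i) * exp (\<kappa> * (\<Sum>m=1..<n. (T m)\<^sup>2)))\<close>
  (lemma \<open>moment_growth_process_bounds\<close>).

  The energy is convex and quadratic, so \<open>T\<^sup>2 = (SUP c. 2 * c * T - c\<^sup>2)\<close>. For a fixed vector \<open>c\<close> of
  tangent points the linearised energy is additive over the sites, and the sum over \<open>k\<close> factorises.
  Its logarithm \<open>A c\<close> is a sum of terms \<open>q * ln (1 + exp (r i))\<close>, minus \<open>\<kappa> * (\<Sum>m=1..<n. (c m)\<^sup>2)\<close>.
  Hence \<open>A c \<le> ln Z\<close> for every \<open>c\<close>
  (lemma \<open>exp_linearised_energy_le_partition_function\<close>). Conversely, the tail sums of all exponent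
  tuples are approximated, with a bounded total error in the energy, by \<open>exp (o n)\<close> many vectors
  \<open>c\<close>, namely integer vectors constant on blocks of length about \<open>sqrt n\<close>; so \<open>ln Z\<close> is at most the supremum of
  \<open>A c\<close>, up to \<open>o n\<close> (lemma \<open>partition_function_le\<close>).

  It remains to compare \<open>A c\<close> with the functional \<open>F g\<close> of the variational problem. Here the entropy
  enters through convex duality: \<open>ln (1 + exp r)\<close> is the maximum of \<open>y * r - I y\<close> over \<open>y\<close> in
  \<open>[0, 1]\<close>, where \<open>I\<close> is \<open>entropy_function\<close>. Given \<open>c\<close>,
  the maximising \<open>y\<close> at each site, times \<open>q\<close>, becomes the slope of a polygonal path \<open>g\<close> on one
  grid interval, and undoing the linearisation by \<open>2 * c * T - c\<^sup>2 \<le> T\<^sup>2\<close> gives \<open>A c \<le> n * F g\<close>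
  (lemma \<open>linearised_energy_le_path_functional\<close>). Given \<open>g\<close>, integrating the duality inequality at
  \<open>y = g' x / q\<close> over the grid intervals, with tangent points \<open>c m = n * (g 1 - g (m / n))\<close>, gives
  \<open>n * F g \<le> A c + \<beta> * q\<^sup>2\<close> (lemma \<open>path_functional_le_linearised_energy\<close>); the fundamental theorem of
  calculus for absolutely continuous functions is used here.
\<close>

section \<open>The entropy function and its convex dual\<close>

lemma mult_ln_ge:
  fixes y t :: real
  assumes "0 \<le> y" "0 < t"
  shows "y * ln t - y * ln y \<le> t - y"
proof (cases "y = 0")
  case False
  with assms have "y * ln (t / y) \<le> y * (t / y - 1)"
    by (intro mult_left_mono ln_le_minus_one) auto
  then show ?thesis
    using False assms by (simp add: ln_div algebra_simps)
qed (use assms in simp)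

text \<open>With \<open>p = exp r / (1 + exp r)\<close>, the difference of the two sides is the relative entropy of the
  Bernoulli laws with parameters \<open>y\<close> and \<open>p\<close>. Its nonnegativity is proved as usual, by applying
  \<open>ln z \<le> z - 1\<close> to each of the two terms.\<close>
lemma fenchel_young_entropy:
  assumes "0 \<le> y" "y \<le> 1"
  shows "y * r - entropy_function y \<le> ln (1 + exp r)"
proof -
  have pos: "1 + exp r > (0::real)"
    by (simp add: add_pos_pos)
  have "y * ln (exp r / (1 + exp r)) - y * ln y \<le> exp r / (1 + exp r) - y"
    using assms pos by (intro mult_ln_ge) auto
  moreover have "(1 - y) * ln (1 / (1 + exp r)) - (1 - y) * ln (1 - y) \<le> 1 / (1 + exp r) - (1 - y)"
    using assms pos by (intro mult_ln_ge) auto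
  moreover have "exp r / (1 + exp r) + 1 / (1 + exp r) = 1"
    using pos by (simp add: field_simps)
  ultimately show ?thesis
    using pos by (simp add: entropy_function_def ln_div algebra_simps)
qed

lemma fenchel_young_entropy_eq:
  defines "y r \<equiv> exp r / (1 + exp r)"
  shows "y r * r - entropy_function (y r) = ln (1 + exp r)"
proof -
  have pos: "1 + exp r > (0::real)"
    by (simp add: add_pos_pos)
  have "ln (y r) = r - ln (1 + exp r)" "ln (1 - y r) = - ln (1 + exp r)"
  proof -
    show "ln (y r) = r - ln (1 + exp r)"
      using pos by (simp add: y_def ln_div)
    have "1 - y r = 1 / (1 + exp r)"
      using pos by (simp add: y_def field_simps)
    then show "ln (1 - y r) = - ln (1 + exp r)"
      using pos by (simp add: ln_div)
  qed
  then show ?thesis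
    unfolding entropy_function_def by (simp only:) (simp add: algebra_simps)
qed

lemma entropy_function_bounds:
  assumes "0 \<le> y" "y \<le> 1"
  shows "- ln 2 \<le> entropy_function y" "entropy_function y \<le> 0"
proof -
  show "- ln 2 \<le> entropy_function y"
    using fenchel_young_entropy[OF assms, of 0] by simp
  have "t * ln t \<le> 0" if "0 \<le> t" "t \<le> 1" for t :: real
    using that by (cases "t = 0") (auto simp: mult_nonneg_nonpos)
  from this[of y] this[of "1 - y"] assms show "entropy_function y \<le> 0"
    by (simp add: entropy_function_def)
qed

lemma borel_measurable_entropy_function [measurable]: "entropy_function \<in> borel_measurable borel"
  unfolding entropy_function_def by measurable

section \<open>The partition function of a quadratic energy and its linearisation\<close>

definition tail_sum :: "nat \<Rightarrow> (nat \<Rightarrow> 'a::comm_monoid_add) \<Rightarrow> nat \<Rightarrow> 'a" where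
  "tail_sum n p m = (\<Sum>i=m..<n. p i)"

text \<open>Summation by parts. It is used three times: to write values of Brownian motion in terms of
  increments, to see that a linearised energy is additive over the sites, and to compute the energy of
  a path from its slopes.\<close>
lemma sum_mult_partial_sums:
  fixes p c :: "nat \<Rightarrow> real"
  shows "(\<Sum>i<n. p i * (\<Sum>m=1..i. c m)) = (\<Sum>m=1..<n. c m * tail_sum n p m)"
proof (induction n)
  case (Suc n)
  have "(\<Sum>m=1..<Suc n. c m * tail_sum (Suc n) p m) = (\<Sum>m=1..<Suc n. c m * tail_sum n p m + p n * c m)"
    by (intro sum.cong) (auto simp: tail_sum_def algebra_simps)
  also have "\<dots> = (\<Sum>m=1..<Suc n. c m * tail_sum n p m) + p n * (\<Sum>m=1..n. c m)"
    by (simp add: sum.distrib sum_distrib_left atLeastLessThanSuc_atLeastAtMost del: sum.op_ivl_Suc)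
  also have "(\<Sum>m=1..<Suc n. c m * tail_sum n p m) = (\<Sum>m=1..<n. c m * tail_sum n p m)"
    by (cases "n = 0") (auto simp: tail_sum_def)
  finally show ?case
    using Suc.IH by (simp del: sum.op_ivl_Suc)
qed simp

definition exponent_tuples :: "nat \<Rightarrow> nat \<Rightarrow> (nat \<Rightarrow> nat) set" where
  "exponent_tuples q n = {..<n} \<rightarrow>\<^sub>E {..q}"

definition binomial_weight :: "real \<Rightarrow> nat \<Rightarrow> nat \<Rightarrow> (nat \<Rightarrow> nat) \<Rightarrow> real" where
  "binomial_weight \<rho> q n k = (\<Prod>i<n. real (q choose k i) * \<rho> ^ k i)"

text \<open>The statistical mechanics reading: \<open>n\<close> sites with spins in \<open>{0..q}\<close>, which carry independent
  weights and interact through the squares of their tail sums with coupling constant \<open>\<kappa>\<close>.\<close>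
definition partition_function :: "real \<Rightarrow> nat \<Rightarrow> nat \<Rightarrow> real \<Rightarrow> real" where
  "partition_function \<rho> q n \<kappa> =
     (\<Sum>k\<in>exponent_tuples q n. binomial_weight \<rho> q n k *
        exp (\<kappa> * (\<Sum>m=1..<n. (tail_sum n (\<lambda>i. real (k i)) m)\<^sup>2)))"

text \<open>The logarithm of the partition function after each \<open>T\<^sup>2\<close> has been replaced by its tangent
  \<open>2 * c * T - c\<^sup>2\<close> at \<open>c\<close>: see lemma \<open>exp_linearised_energy\<close>.\<close>
definition linearised_energy :: "real \<Rightarrow> nat \<Rightarrow> nat \<Rightarrow> real \<Rightarrow> (nat \<Rightarrow> real) \<Rightarrow> real" where
  "linearised_energy \<rho> q n \<kappa> c =
     (\<Sum>i<n. real q * ln (1 + \<rho> * exp (2 * \<kappa> * (\<Sum>m=1..i. c m)))) - \<kappa> * (\<Sum>m=1..<n. (c m)\<^sup>2)"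

lemma finite_exponent_tuples [simp, intro]: "finite (exponent_tuples q n)"
  by (auto simp: exponent_tuples_def intro: finite_PiE)

lemma binomial_weight_nonneg: "0 < \<rho> \<Longrightarrow> 0 \<le> binomial_weight \<rho> q n k"
  by (auto simp: binomial_weight_def intro!: prod_nonneg)

lemma prod_affine_power_expand:
  fixes \<rho> :: real and y :: "nat \<Rightarrow> real"
  shows "(\<Prod>i<n. (1 + \<rho> * y i) ^ q) =
    (\<Sum>k\<in>exponent_tuples q n. binomial_weight \<rho> q n k * (\<Prod>i<n. y i ^ k i))"
proof -
  have "(1 + \<rho> * y i) ^ q = (\<Sum>k\<le>q. real (q choose k) * \<rho> ^ k * y i ^ k)" for i
    using binomial_ring[of "\<rho> * y i" 1 q] by (simp add: power_mult_distrib algebra_simps)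
  then show ?thesis
    by (simp add: prod_sum_PiE exponent_tuples_def binomial_weight_def prod.distrib)
qed

text \<open>A linear energy is a sum over the sites, so the sum over all exponent tuples is the expansion of
  a product of \<open>n\<close> binomials.\<close>
lemma exp_linearised_energy:
  assumes "\<rho> > 0"
  shows "exp (linearised_energy \<rho> q n \<kappa> c) =
    (\<Sum>k\<in>exponent_tuples q n. binomial_weight \<rho> q n k *
        exp (\<kappa> * (\<Sum>m=1..<n. 2 * c m * tail_sum n (\<lambda>i. real (k i)) m - (c m)\<^sup>2)))"
proof -
  define \<Lambda> where "\<Lambda> i = 2 * \<kappa> * (\<Sum>m=1..i. c m)" for i
  have pos: "1 + \<rho> * exp (\<Lambda> i) > 0" for i
    using assms by (simp add: add_pos_pos)
  have "(\<Prod>i<n. exp (\<Lambda> i) ^ k i) =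
      exp (2 * \<kappa> * (\<Sum>m=1..<n. c m * tail_sum n (\<lambda>i. real (k i)) m))" for k :: "nat \<Rightarrow> nat"
  proof -
    have "(\<Sum>i<n. real (k i) * \<Lambda> i) = 2 * \<kappa> * (\<Sum>i<n. real (k i) * (\<Sum>m=1..i. c m))"
      by (simp add: \<Lambda>_def sum_distrib_left mult_ac)
    also note sum_mult_partial_sums
    finally show ?thesis
      by (simp add: exp_of_nat_mult[symmetric] exp_sum[symmetric])
  qed
  note monomial = this
  have "exp (linearised_energy \<rho> q n \<kappa> c) =
      exp (- \<kappa> * (\<Sum>m=1..<n. (c m)\<^sup>2)) * (\<Prod>i<n. exp (real q * ln (1 + \<rho> * exp (\<Lambda> i))))"
    unfolding linearised_energy_def \<Lambda>_def[symmetric]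
    by (simp add: exp_diff exp_minus exp_sum divide_inverse mult.commute)
  also have "(\<Prod>i<n. exp (real q * ln (1 + \<rho> * exp (\<Lambda> i)))) = (\<Prod>i<n. (1 + \<rho> * exp (\<Lambda> i)) ^ q)"
    using pos by (simp add: exp_of_nat_mult)
  also have "exp (- \<kappa> * (\<Sum>m=1..<n. (c m)\<^sup>2)) * \<dots> =
      (\<Sum>k\<in>exponent_tuples q n. binomial_weight \<rho> q n k *
        (exp (- \<kappa> * (\<Sum>m=1..<n. (c m)\<^sup>2)) *
         exp (2 * \<kappa> * (\<Sum>m=1..<n. c m * tail_sum n (\<lambda>i. real (k i)) m))))"
    unfolding prod_affine_power_expand monomial by (simp add: sum_distrib_left mult_ac)
  also have "\<dots> = (\<Sum>k\<in>exponent_tuples q n. binomial_weight \<rho> q n k *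
        exp (\<kappa> * (\<Sum>m=1..<n. 2 * c m * tail_sum n (\<lambda>i. real (k i)) m - (c m)\<^sup>2)))"
    by (simp add: exp_add[symmetric] sum_subtractf sum_negf sum_distrib_left algebra_simps)
  finally show ?thesis .
qed

lemma exp_linearised_energy_le_partition_function:
  assumes "\<rho> > 0" "\<kappa> \<ge> 0"
  shows "exp (linearised_energy \<rho> q n \<kappa> c) \<le> partition_function \<rho> q n \<kappa>"
  unfolding exp_linearised_energy[OF assms(1)] partition_function_def
proof (intro sum_mono mult_left_mono binomial_weight_nonneg assms)
  fix k :: "nat \<Rightarrow> nat"
  have "2 * c m * t - (c m)\<^sup>2 \<le> t\<^sup>2" for m t
    using zero_le_power2[of "t - c m"] by (simp add: power2_eq_square algebra_simps)
  then show "exp (\<kappa> * (\<Sum>m=1..<n. 2 * c m * tail_sum n (\<lambda>i. real (k i)) m - (c m)\<^sup>2))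
      \<le> exp (\<kappa> * (\<Sum>m=1..<n. (tail_sum n (\<lambda>i. real (k i)) m)\<^sup>2))"
    using assms by (intro exp_mono mult_left_mono sum_mono) auto
qed

lemma partition_function_pos:
  assumes "\<rho> > 0" "\<kappa> \<ge> 0"
  shows "partition_function \<rho> q n \<kappa> > 0"
  using exp_linearised_energy_le_partition_function[OF assms, of q n "\<lambda>_. 0"]
  by (rule less_le_trans[rotated]) simp

text \<open>Moving the start of a tail sum down to the beginning of its block of length \<open>L\<close> adds at most
  \<open>L\<close> terms, each at most \<open>q\<close>. A tuple is thus described up to this error by one number for
  each block.\<close>
lemma tail_sum_block_approx:
  assumes "k \<in> exponent_tuples q n" "L > 0" "m < n"
  shows "\<bar>real (tail_sum n k (L * (m div L))) - tail_sum n (\<lambda>i. real (k i)) m\<bar> \<le> real q * real L"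
proof -
  define m' where "m' = L * (m div L)"
  have m': "m' \<le> m" "m - m' \<le> L"
  proof -
    show "m' \<le> m" by (simp add: m'_def)
    have "m mod L \<le> L" using assms by (simp add: less_imp_le)
    then show "m - m' \<le> L" by (simp add: m'_def minus_mult_div_eq_mod)
  qed
  have le: "k i \<le> q" if "i < n" for i
    using assms(1) that by (auto simp: exponent_tuples_def PiE_iff)
  have "tail_sum n k m' = (\<Sum>i=m'..<m. k i) + tail_sum n k m"
    unfolding tail_sum_def using m' assms by (intro sum.atLeastLessThan_concat[symmetric]) auto
  then have "real (tail_sum n k m') - tail_sum n (\<lambda>i. real (k i)) m = real (\<Sum>i=m'..<m. k i)"
    by (simp add: tail_sum_def)
  also have "(\<Sum>i=m'..<m. k i) \<le> (\<Sum>i=m'..<m. q)"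
    using assms by (intro sum_mono le) auto
  also have "\<dots> \<le> L * q"
    using m' by simp
  also have "real (L * q) = real q * real L" by simp
  finally have "real (tail_sum n k m') - tail_sum n (\<lambda>i. real (k i)) m \<le> real q * real L"
    by linarith
  moreover have "0 \<le> real (tail_sum n k m') - tail_sum n (\<lambda>i. real (k i)) m"
    unfolding \<open>real (tail_sum n k m') - _ = _\<close> by (rule of_nat_0_le_iff)
  ultimately show ?thesis
    unfolding m'_def by linarith
qed

text \<open>Each exponent tuple is assigned the tangent points given by its tail sums at the block starts.
  Replacing \<open>T\<^sup>2\<close> by the tangent costs \<open>(T - c)\<^sup>2\<close>, which is at most \<open>(q * L)\<^sup>2\<close>. The union bound over the
  possible vectors of block values (the set \<open>net\<close>) then reduces the partition function to
  linearised energies.\<close>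
lemma partition_function_le:
  assumes "\<rho> > 0" "\<kappa> \<ge> 0" "L > 0" and B: "\<And>c. linearised_energy \<rho> q n \<kappa> c \<le> B"
  shows "partition_function \<rho> q n \<kappa> \<le>
    real (n * q + 1) ^ (n div L + 1) * exp (B + \<kappa> * real n * (real q * real L)\<^sup>2)"
proof -
  define net where "net = ({..n div L} \<rightarrow>\<^sub>E {..n * q})"
  define c where "c s m = real (s (m div L))" for s :: "nat \<Rightarrow> nat" and m
  define \<Delta> where "\<Delta> = \<kappa> * real n * (real q * real L)\<^sup>2"
  define E where "E s k = exp (\<kappa> * (\<Sum>m=1..<n. 2 * c s m * tail_sum n (\<lambda>i. real (k i)) m - (c s m)\<^sup>2))"
    for s k :: "nat \<Rightarrow> nat"
  have fin: "finite net" by (auto simp: net_def intro: finite_PiE)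
  have card: "card net = (n * q + 1) ^ (n div L + 1)"
    by (simp add: net_def card_PiE)
  have cover: "exp (\<kappa> * (\<Sum>m=1..<n. (tail_sum n (\<lambda>i. real (k i)) m)\<^sup>2)) \<le> (\<Sum>s\<in>net. exp \<Delta> * E s k)"
    if k: "k \<in> exponent_tuples q n" for k
  proof -
    define s where "s = restrict (\<lambda>j. tail_sum n k (L * j)) {..n div L}"
    have le: "k i \<le> q" if "i < n" for i
      using k that by (auto simp: exponent_tuples_def PiE_iff)
    have "tail_sum n k j \<le> n * q" for j
    proof -
      have "tail_sum n k j \<le> (\<Sum>i=j..<n. q)"
        unfolding tail_sum_def by (intro sum_mono le) auto
      then show ?thesis by (simp add: order_trans[OF _ mult_le_mono1])
    qed
    then have s: "s \<in> net" by (auto simp: s_def net_def)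
    have "(tail_sum n (\<lambda>i. real (k i)) m)\<^sup>2 \<le>
        (2 * c s m * tail_sum n (\<lambda>i. real (k i)) m - (c s m)\<^sup>2) + (real q * real L)\<^sup>2"
      if "m \<in> {1..<n}" for m
    proof -
      have "m div L \<le> n div L" using that by (intro div_le_mono) auto
      then have "c s m = real (tail_sum n k (L * (m div L)))"
        by (simp add: c_def s_def)
      with tail_sum_block_approx[OF k \<open>L > 0\<close>, of m] that
      have "\<bar>c s m - tail_sum n (\<lambda>i. real (k i)) m\<bar> \<le> real q * real L" by simp
      then have "(c s m - tail_sum n (\<lambda>i. real (k i)) m)\<^sup>2 \<le> (real q * real L)\<^sup>2"
        by (metis abs_ge_zero power2_abs power_mono)
      then show ?thesis by (simp add: power2_eq_square algebra_simps)
    qed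
    then have "(\<Sum>m=1..<n. (tail_sum n (\<lambda>i. real (k i)) m)\<^sup>2) \<le>
      (\<Sum>m=1..<n. (2 * c s m * tail_sum n (\<lambda>i. real (k i)) m - (c s m)\<^sup>2) + (real q * real L)\<^sup>2)"
      by (rule sum_mono)
    also have "\<dots> \<le> (\<Sum>m=1..<n. 2 * c s m * tail_sum n (\<lambda>i. real (k i)) m - (c s m)\<^sup>2)
        + real n * (real q * real L)\<^sup>2"
      by (simp add: sum.distrib mult_right_mono)
    finally have "\<kappa> * (\<Sum>m=1..<n. (tail_sum n (\<lambda>i. real (k i)) m)\<^sup>2) \<le>
      \<Delta> + \<kappa> * (\<Sum>m=1..<n. 2 * c s m * tail_sum n (\<lambda>i. real (k i)) m - (c s m)\<^sup>2)"
      using mult_left_mono[OF _ \<open>\<kappa> \<ge> 0\<close>] by (fastforce simp: \<Delta>_def algebra_simps)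
    then have "exp (\<kappa> * (\<Sum>m=1..<n. (tail_sum n (\<lambda>i. real (k i)) m)\<^sup>2)) \<le> exp \<Delta> * E s k"
      by (simp add: E_def exp_add[symmetric])
    also have "\<dots> \<le> (\<Sum>s\<in>net. exp \<Delta> * E s k)"
      by (rule member_le_sum[OF s _ fin]) (simp add: E_def)
    finally show ?thesis .
  qed
  have "partition_function \<rho> q n \<kappa> \<le>
      (\<Sum>k\<in>exponent_tuples q n. binomial_weight \<rho> q n k * (\<Sum>s\<in>net. exp \<Delta> * E s k))"
    unfolding partition_function_def using assms
    by (intro sum_mono mult_left_mono cover binomial_weight_nonneg) auto
  also have "\<dots> = exp \<Delta> * (\<Sum>s\<in>net. \<Sum>k\<in>exponent_tuples q n. binomial_weight \<rho> q n k * E s k)"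
    by (simp add: sum_distrib_left mult_ac sum.swap[of _ net])
  also have "\<dots> = exp \<Delta> * (\<Sum>s\<in>net. exp (linearised_energy \<rho> q n \<kappa> (c s)))"
    unfolding exp_linearised_energy[OF \<open>\<rho> > 0\<close>] E_def by simp
  also have "\<dots> \<le> exp \<Delta> * (\<Sum>s\<in>net. exp B)"
    by (intro mult_left_mono sum_mono exp_mono B) auto
  also have "\<dots> = real (n * q + 1) ^ (n div L + 1) * exp (B + \<Delta>)"
    by (simp add: card exp_add algebra_simps)
  finally show ?thesis
    unfolding \<Delta>_def .
qed

section \<open>Moments of the growth process\<close>

lemma (in prob_space) exponential_moment_normal:
  assumes X: "distributed M lborel X (normal_density 0 s)" and s: "s > 0"
  shows "integrable M (\<lambda>\<omega>. exp (a * X \<omega>))"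
    and "expectation (\<lambda>\<omega>. exp (a * X \<omega>)) = exp (a\<^sup>2 * s\<^sup>2 / 2)"
proof -
  have eq: "normal_density 0 s x * exp (a * x) = exp (a\<^sup>2 * s\<^sup>2 / 2) * normal_density (a * s\<^sup>2) s x" for x
  proof -
    have "- (x - 0)\<^sup>2 / (2 * s\<^sup>2) + a * x = a\<^sup>2 * s\<^sup>2 / 2 - (x - a * s\<^sup>2)\<^sup>2 / (2 * s\<^sup>2)"
      using s by (simp add: field_simps power2_eq_square)
    then have "exp (- (x - 0)\<^sup>2 / (2 * s\<^sup>2)) * exp (a * x) =
        exp (a\<^sup>2 * s\<^sup>2 / 2) * exp (- (x - a * s\<^sup>2)\<^sup>2 / (2 * s\<^sup>2))"
      unfolding exp_add[symmetric] by simp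
    then show ?thesis
      by (simp add: normal_density_def)
  qed
  have "integrable lborel (\<lambda>x. normal_density 0 s x * exp (a * x))"
    unfolding eq using s by simp
  then show "integrable M (\<lambda>\<omega>. exp (a * X \<omega>))"
    using distributed_integrable[OF X, of "\<lambda>x. exp (a * x)"] by simp
  have "(\<integral>x. normal_density 0 s x * exp (a * x) \<partial>lborel) = exp (a\<^sup>2 * s\<^sup>2 / 2)"
    unfolding eq using s by simp
  then show "expectation (\<lambda>\<omega>. exp (a * X \<omega>)) = exp (a\<^sup>2 * s\<^sup>2 / 2)"
    using distributed_integral[OF X, of "\<lambda>x. exp (a * x)"] by simp
qed

text \<open>The tail sum of \<open>p\<close> at \<open>m\<close> is the total coefficient of the increment of \<open>W\<close> ending at time
  \<open>m * \<tau>\<close>; the increments are independent, and each contributes its Gaussian exponential moment.\<close>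
lemma (in standard_brownian_motion) exponential_moment_grid:
  fixes p :: "nat \<Rightarrow> real"
  assumes "\<tau> > 0"
  shows "integrable M (\<lambda>\<omega>. exp (\<Sum>i<n. p i * W (real i * \<tau>) \<omega>))"
    and "expectation (\<lambda>\<omega>. exp (\<Sum>i<n. p i * W (real i * \<tau>) \<omega>)) =
      exp (\<tau> / 2 * (\<Sum>m=1..<n. (tail_sum n p m)\<^sup>2))"
proof -
  \<comment> \<open>The grid is delayed by one step, so that the \<open>m\<close>-th increment ends at time \<open>m * \<tau>\<close>;
    the increment with index \<open>0\<close> is trivial.\<close>
  define t where "t i = real (i - 1) * \<tau>" for i :: nat
  define D where "D m \<omega> = W (t (Suc m)) \<omega> - W (t m) \<omega>" for m \<omega>
  define Y where "Y m \<omega> = exp (tail_sum n p m * D m \<omega>)" for m \<omega>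
  have "mono t"
    using assms by (auto simp: t_def mono_def intro!: mult_right_mono)
  have t0: "0 \<le> t i" for i using assms by (simp add: t_def)
  have indep: "indep_vars (\<lambda>_. borel) D {1..<n}"
    using independent_increments[of t n] \<open>mono t\<close> t0 unfolding D_def
    by (rule_tac indep_vars_subset[of _ _ "{..<n}"]) auto
  have indep_Y: "indep_vars (\<lambda>_. borel) Y {1..<n}"
    unfolding Y_def by (rule indep_vars_compose2[OF indep]) measurable
  have D: "distributed M lborel (D m) (normal_density 0 (sqrt \<tau>))" if "m \<in> {1..<n}" for m
  proof -
    have "t (Suc m) - t m = \<tau>" using that by (simp add: t_def of_nat_diff algebra_simps)
    then show ?thesis
      using normal_increments[of "t m" "t (Suc m)"] t0 assms unfolding D_def by simp
  qed
  have int_Y: "integrable M (Y m)" and exp_Y: "expectation (Y m) = exp ((tail_sum n p m)\<^sup>2 * \<tau> / 2)"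
    if "m \<in> {1..<n}" for m
    using exponential_moment_normal[OF D[OF that], of "tail_sum n p m"] assms
    by (auto simp: Y_def[abs_def])
  have "integrable M (\<lambda>\<omega>. \<Prod>m\<in>{1..<n}. Y m \<omega>)"
    by (rule indep_vars_integrable[OF _ indep_Y int_Y]) auto
  have "expectation (\<lambda>\<omega>. \<Prod>m\<in>{1..<n}. Y m \<omega>) = (\<Prod>m\<in>{1..<n}. exp ((tail_sum n p m)\<^sup>2 * \<tau> / 2))"
    by (subst indep_vars_lebesgue_integral[OF _ indep_Y int_Y]) (auto simp: exp_Y intro!: prod.cong)
  also have "\<dots> = exp (\<tau> / 2 * (\<Sum>m=1..<n. (tail_sum n p m)\<^sup>2))"
    by (simp add: exp_sum[symmetric] sum_distrib_left mult_ac)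
  finally have E: "expectation (\<lambda>\<omega>. \<Prod>m\<in>{1..<n}. Y m \<omega>) = exp (\<tau> / 2 * (\<Sum>m=1..<n. (tail_sum n p m)\<^sup>2))" .
  have AE: "AE \<omega> in M. (\<Prod>m\<in>{1..<n}. Y m \<omega>) = exp (\<Sum>i<n. p i * W (real i * \<tau>) \<omega>)"
    using AE_starts_at_0
  proof eventually_elim
    case (elim \<omega>)
    have W: "W (real i * \<tau>) \<omega> = (\<Sum>m=1..i. D m \<omega>)" for i
      by (induction i) (auto simp: elim D_def t_def)
    show ?case
      unfolding W sum_mult_partial_sums Y_def
      by (simp add: exp_sum mult.commute)
  qed
  have [measurable]: "random_variable borel (W (real i * \<tau>))" for i
    using assms by (intro random_variable_W) auto
  have [measurable]: "random_variable borel (D m)" for m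
    unfolding D_def by (intro borel_measurable_diff random_variable_W t0)
  have [measurable]: "random_variable borel (\<lambda>\<omega>. \<Prod>m\<in>{1..<n}. Y m \<omega>)"
    unfolding Y_def by measurable
  show "integrable M (\<lambda>\<omega>. exp (\<Sum>i<n. p i * W (real i * \<tau>) \<omega>))"
    using \<open>integrable M (\<lambda>\<omega>. \<Prod>m\<in>{1..<n}. Y m \<omega>)\<close> AE
    by (subst integrable_cong_AE[symmetric]) auto
  show "expectation (\<lambda>\<omega>. exp (\<Sum>i<n. p i * W (real i * \<tau>) \<omega>)) =
      exp (\<tau> / 2 * (\<Sum>m=1..<n. (tail_sum n p m)\<^sup>2))"
    unfolding E[symmetric] using AE
    by (intro integral_cong_AE[symmetric]) (auto simp del: One_nat_def)
qed

lemma growth_process_eq_prod: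
  "growth_process W \<rho> \<sigma> \<tau> x0 n \<omega> = x0 * (\<Prod>i<n. growth_factor W \<rho> \<sigma> \<tau> i \<omega>)"
  by (induction n) auto

lemma (in standard_brownian_motion) moment_growth_process:
  fixes \<sigma> :: real
  assumes "\<tau> > 0"
  defines "\<kappa> \<equiv> 1/2 * \<sigma>\<^sup>2 * \<tau>"
  shows "expectation (\<lambda>\<omega>. growth_process W \<rho> \<sigma> \<tau> x0 n \<omega> ^ q) =
    x0 ^ q * (\<Sum>k\<in>exponent_tuples q n. binomial_weight \<rho> q n k *
        exp (- \<kappa> * (\<Sum>i<n. real (k i) * real i)) *
        exp (\<kappa> * (\<Sum>m=1..<n. (tail_sum n (\<lambda>i. real (k i)) m)\<^sup>2)))"
proof -
  define p where "p k i = \<sigma> * real (k i)" for k :: "nat \<Rightarrow> nat" and i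
  define w where "w k = binomial_weight \<rho> q n k * exp (- \<kappa> * (\<Sum>i<n. real (k i) * real i))" for k
  have expand: "growth_process W \<rho> \<sigma> \<tau> x0 n \<omega> ^ q =
      x0 ^ q * (\<Sum>k\<in>exponent_tuples q n. w k * exp (\<Sum>i<n. p k i * W (real i * \<tau>) \<omega>))" for \<omega>
  proof -
    define y where "y i = exp (\<sigma> * W (real i * \<tau>) \<omega> - 1/2 * \<sigma>\<^sup>2 * (real i * \<tau>))" for i
    have "(\<Prod>i<n. y i ^ k i) = exp (- \<kappa> * (\<Sum>i<n. real (k i) * real i)) *
        exp (\<Sum>i<n. p k i * W (real i * \<tau>) \<omega>)" for k
      by (simp add: y_def exp_of_nat_mult[symmetric] exp_sum[symmetric] exp_add[symmetric]
          p_def \<kappa>_def sum_distrib_left sum_subtractf algebra_simps)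
    then show ?thesis
      using prod_affine_power_expand[where \<rho>=\<rho> and y=y and q=q and n=n]
      by (simp add: growth_process_eq_prod growth_factor_def y_def power_mult_distrib
          prod_power_distrib w_def mult_ac)
  qed
  have "expectation (\<lambda>\<omega>. growth_process W \<rho> \<sigma> \<tau> x0 n \<omega> ^ q) =
      x0 ^ q * (\<Sum>k\<in>exponent_tuples q n. w k * exp (\<tau> / 2 * (\<Sum>m=1..<n. (tail_sum n (p k) m)\<^sup>2)))"
    unfolding expand using exponential_moment_grid[OF assms(1)] by simp
  moreover have "\<tau> / 2 * (\<Sum>m=1..<n. (tail_sum n (p k) m)\<^sup>2) =
      \<kappa> * (\<Sum>m=1..<n. (tail_sum n (\<lambda>i. real (k i)) m)\<^sup>2)" for k
    by (simp add: p_def tail_sum_def \<kappa>_def sum_distrib_left[symmetric] power_mult_distrib)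
  ultimately show ?thesis
    unfolding w_def by simp
qed

text \<open>The martingale correction \<open>- 1/2 * \<sigma>\<^sup>2 * (i * \<tau>)\<close> in the growth factors is linear in the
  exponents, whereas the energy is quadratic. In the regime \<open>\<kappa> = \<beta> / n\<^sup>2\<close> it changes the moment by no
  more than the factor \<open>exp (- \<beta> * q)\<close>, invisible on the exponential scale.\<close>
lemma (in standard_brownian_motion) moment_growth_process_bounds:
  fixes \<sigma> :: real and n q :: nat
  assumes "\<tau> > 0" "\<rho> > 0" "x0 > 0"
  defines "\<kappa> \<equiv> 1/2 * \<sigma>\<^sup>2 * \<tau>"
  defines "E \<equiv> expectation (\<lambda>\<omega>. growth_process W \<rho> \<sigma> \<tau> x0 n \<omega> ^ q)"
  shows "exp (- \<kappa> * (real q * (real n)\<^sup>2)) * (x0 ^ q * partition_function \<rho> q n \<kappa>) \<le> E"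
    and "E \<le> x0 ^ q * partition_function \<rho> q n \<kappa>"
proof -
  define d where "d k = (\<Sum>i<n. real (k i) * real i)" for k :: "nat \<Rightarrow> nat"
  define Q where "Q k = exp (\<kappa> * (\<Sum>m=1..<n. (tail_sum n (\<lambda>i. real (k i)) m)\<^sup>2))" for k :: "nat \<Rightarrow> nat"
  have "\<kappa> \<ge> 0" using assms by (simp add: \<kappa>_def)
  have E: "E = x0 ^ q * (\<Sum>k\<in>exponent_tuples q n. binomial_weight \<rho> q n k * exp (- \<kappa> * d k) * Q k)"
    unfolding E_def \<kappa>_def d_def Q_def by (rule moment_growth_process[OF assms(1)])
  have d: "0 \<le> d k" "d k \<le> real q * (real n)\<^sup>2" if "k \<in> exponent_tuples q n" for k
  proof -
    show "0 \<le> d k" by (auto simp: d_def intro: sum_nonneg)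
    have "real (k i) * real i \<le> real q * real n" if "i < n" for i
      using that \<open>k \<in> exponent_tuples q n\<close> by (intro mult_mono) (auto simp: exponent_tuples_def PiE_iff)
    then have "d k \<le> (\<Sum>i<n. real q * real n)"
      unfolding d_def by (intro sum_mono) auto
    then show "d k \<le> real q * (real n)\<^sup>2" by (simp add: power2_eq_square mult_ac)
  qed
  have Z: "partition_function \<rho> q n \<kappa> = (\<Sum>k\<in>exponent_tuples q n. binomial_weight \<rho> q n k * Q k)"
    by (simp add: partition_function_def Q_def)
  have bw: "0 \<le> binomial_weight \<rho> q n k" for k
    using assms by (rule_tac binomial_weight_nonneg)
  have "binomial_weight \<rho> q n k * exp (- \<kappa> * d k) * Q k \<le> binomial_weight \<rho> q n k * 1 * Q k"
    if "k \<in> exponent_tuples q n" for k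
    using d[OF that] \<open>\<kappa> \<ge> 0\<close> bw by (intro mult_right_mono mult_left_mono) (auto simp: Q_def)
  then show "E \<le> x0 ^ q * partition_function \<rho> q n \<kappa>"
    unfolding E Z using assms(3) by (intro mult_left_mono sum_mono) auto
  have "binomial_weight \<rho> q n k * exp (- \<kappa> * (real q * (real n)\<^sup>2)) * Q k
      \<le> binomial_weight \<rho> q n k * exp (- \<kappa> * d k) * Q k"
    if "k \<in> exponent_tuples q n" for k
  proof -
    have "- \<kappa> * (real q * (real n)\<^sup>2) \<le> - \<kappa> * d k"
      using mult_left_mono[OF d(2)[OF that] \<open>\<kappa> \<ge> 0\<close>] by simp
    then have "exp (- \<kappa> * (real q * (real n)\<^sup>2)) \<le> exp (- \<kappa> * d k)" by simp
    then show ?thesis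
      by (intro mult_right_mono mult_left_mono[OF _ bw]) (auto simp: Q_def)
  qed
  then have "(\<Sum>k\<in>exponent_tuples q n. binomial_weight \<rho> q n k * exp (- \<kappa> * (real q * (real n)\<^sup>2)) * Q k)
      \<le> (\<Sum>k\<in>exponent_tuples q n. binomial_weight \<rho> q n k * exp (- \<kappa> * d k) * Q k)"
    by (rule sum_mono)
  then have "x0 ^ q * (\<Sum>k\<in>exponent_tuples q n. binomial_weight \<rho> q n k * exp (- \<kappa> * (real q * (real n)\<^sup>2)) * Q k) \<le> E"
    unfolding E using assms(3) by (intro mult_left_mono) auto
  then show "exp (- \<kappa> * (real q * (real n)\<^sup>2)) * (x0 ^ q * partition_function \<rho> q n \<kappa>) \<le> E"
    unfolding Z by (simp add: sum_distrib_left mult_ac)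
qed

section \<open>Absolutely continuous functions\<close>

lemma absolutely_continuous_fun_on_subset:
  assumes "absolutely_continuous_fun_on T f" "S \<subseteq> T"
  shows "absolutely_continuous_fun_on S f"
proof -
  have "(\<forall>(a, b)\<in>D. a < b \<and> {a..b} \<subseteq> S) \<Longrightarrow> (\<forall>(a, b)\<in>D. a < b \<and> {a..b} \<subseteq> T)"
    for D :: "(real \<times> real) set"
    using assms(2) by blast
  with assms(1) show ?thesis
    unfolding absolutely_continuous_fun_on_def by meson
qed

lemma lipschitz_imp_absolutely_continuous_fun_on:
  assumes lip: "\<And>x y. x \<in> S \<Longrightarrow> y \<in> S \<Longrightarrow> \<bar>f y - f x\<bar> \<le> C * \<bar>y - x\<bar>"
  shows "absolutely_continuous_fun_on S f"
  unfolding absolutely_continuous_fun_on_def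
proof (intro allI impI)
  fix \<epsilon> :: real assume "\<epsilon> > 0"
  define C' where "C' = \<bar>C\<bar> + 1"
  have "C' > 0" by (simp add: C'_def)
  show "\<exists>\<delta>>0. \<forall>D :: (real \<times> real) set.
        finite D \<longrightarrow> (\<forall>(a, b)\<in>D. a < b \<and> {a..b} \<subseteq> S) \<longrightarrow>
        disjoint_family_on (\<lambda>(a, b). {a<..<b}) D \<longrightarrow>
        (\<Sum>(a, b)\<in>D. b - a) < \<delta> \<longrightarrow> (\<Sum>(a, b)\<in>D. \<bar>f b - f a\<bar>) < \<epsilon>"
  proof (intro exI[of _ "\<epsilon> / C'"] conjI allI impI)
    show "\<epsilon> / C' > 0" using \<open>\<epsilon> > 0\<close> \<open>C' > 0\<close> by simp
    fix D :: "(real \<times> real) set"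
    assume D: "\<forall>(a, b)\<in>D. a < b \<and> {a..b} \<subseteq> S" and small: "(\<Sum>(a, b)\<in>D. b - a) < \<epsilon> / C'"
    have "\<bar>f b - f a\<bar> \<le> C' * (b - a)" if "(a, b) \<in> D" for a b
    proof -
      have ab: "a < b" "{a..b} \<subseteq> S" using D that by auto
      then have "\<bar>f b - f a\<bar> \<le> C * \<bar>b - a\<bar>" by (intro lip) auto
      also have "\<dots> \<le> C' * \<bar>b - a\<bar>" by (intro mult_right_mono) (auto simp: C'_def)
      finally show ?thesis using ab by simp
    qed
    then have "(\<Sum>(a, b)\<in>D. \<bar>f b - f a\<bar>) \<le> (\<Sum>(a, b)\<in>D. C' * (b - a))"
      by (intro sum_mono) auto
    also have "\<dots> = C' * (\<Sum>(a, b)\<in>D. b - a)"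
      by (simp add: sum_distrib_left case_prod_unfold)
    also have "\<dots> < \<epsilon>"
      using small \<open>C' > 0\<close> by (simp add: field_simps)
    finally show "(\<Sum>(a, b)\<in>D. \<bar>f b - f a\<bar>) < \<epsilon>" .
  qed
qed

text \<open>The fundamental theorem of calculus for absolutely continuous functions. Choose a gauge that at
  points outside \<open>N\<close> makes difference quotients close to the derivative, and at points of \<open>N\<close> keeps
  the interval inside an open set \<open>U \<supseteq> N\<close> of measure less than \<open>\<delta>\<close>. In a fine tagged division the
  intervals with tag outside \<open>N\<close> contribute a small error by differentiability; those with tag in
  \<open>N\<close> are disjoint with total length less than \<open>\<delta>\<close>, so absolute continuity bounds the variation of
  \<open>g\<close> on them.\<close>
lemma absolutely_continuous_has_integral_derivative:
  fixes g :: "real \<Rightarrow> real"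
  assumes "a \<le> b" and ac: "absolutely_continuous_fun_on {a..b} g"
    and N: "negligible N" and der: "\<And>x. x \<in> {a..b} - N \<Longrightarrow> (g has_real_derivative g' x) (at x)"
  shows "(g' has_integral (g b - g a)) {a..b}"
proof -
  define f where "f x = (if x \<in> N then 0 else g' x)" for x
  have "(f has_integral (g b - g a)) {a..b}"
    unfolding has_integral_real
  proof (intro allI impI)
    fix \<epsilon> :: real assume "\<epsilon> > 0"
    \<comment> \<open>The summand \<open>1\<close> only avoids a division by zero when \<open>a = b\<close>.\<close>
    define e where "e = \<epsilon> / (2 * (b - a + 1))"
    have "e > 0" using \<open>\<epsilon> > 0\<close> \<open>a \<le> b\<close> by (simp add: e_def)
    have "e * (b - a) < \<epsilon> / 2"
      using \<open>\<epsilon> > 0\<close> \<open>a \<le> b\<close> by (simp add: e_def field_simps)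
    obtain \<delta> where "\<delta> > 0" and \<delta>: "\<And>D :: (real \<times> real) set.
        finite D \<Longrightarrow> (\<forall>(u, v)\<in>D. u < v \<and> {u..v} \<subseteq> {a..b}) \<Longrightarrow>
        disjoint_family_on (\<lambda>(u, v). {u<..<v}) D \<Longrightarrow>
        (\<Sum>(u, v)\<in>D. v - u) < \<delta> \<Longrightarrow> (\<Sum>(u, v)\<in>D. \<bar>g v - g u\<bar>) < \<epsilon> / 2"
      using ac \<open>\<epsilon> > 0\<close> unfolding absolutely_continuous_fun_on_def
      by (metis (no_types, lifting) half_gt_zero)
    have "N \<in> sets lebesgue"
      using N by (simp add: negligible_imp_sets)
    from sets_lebesgue_outer_open[OF this \<open>\<delta> > 0\<close>]
    obtain U where U: "open U" "N \<subseteq> U" "U - N \<in> lmeasurable" "emeasure lebesgue (U - N) < ennreal \<delta>"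
      by blast
    have emU: "emeasure lebesgue U < ennreal \<delta>"
    proof -
      have "emeasure lebesgue U = emeasure lebesgue (U - N)"
        using N U by (intro emeasure_Diff_null_set[symmetric])
          (auto simp: negligible_iff_null_sets)
      then show ?thesis using U by simp
    qed
    have "\<exists>d>0. (x \<in> N \<longrightarrow> ball x d \<subseteq> U) \<and>
        (x \<in> {a..b} - N \<longrightarrow> (\<forall>y. norm (y - x) < d \<longrightarrow> norm (g y - g x - (y - x) * g' x) \<le> e * norm (y - x)))" for x
    proof (cases "x \<in> N")
      case True
      then show ?thesis using U by (metis DiffD2 open_contains_ball_eq subsetD)
    next
      case False
      show ?thesis
      proof (cases "x \<in> {a..b}")
        case True
        with False der have "(g has_real_derivative g' x) (at x)" by auto
        then show ?thesis
          using \<open>e > 0\<close> False unfolding has_field_derivative_def has_derivative_at_alt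
          by (simp add: mult.commute) blast
      qed (use False in \<open>auto intro: exI[of _ 1]\<close>)
    qed
    then obtain d where d: "\<And>x. d x > 0" "\<And>x. x \<in> N \<Longrightarrow> ball x (d x) \<subseteq> U"
      "\<And>x y. x \<in> {a..b} - N \<Longrightarrow> norm (y - x) < d x \<Longrightarrow> norm (g y - g x - (y - x) * g' x) \<le> e * norm (y - x)"
      by metis
    show "\<exists>\<gamma>. gauge \<gamma> \<and> (\<forall>\<D>. \<D> tagged_division_of {a..b} \<and> \<gamma> fine \<D> \<longrightarrow>
        norm ((\<Sum>(x, K)\<in>\<D>. measure lborel K *\<^sub>R f x) - (g b - g a)) < \<epsilon>)"
    proof (intro exI[of _ "\<lambda>x. ball x (d x)"] conjI allI impI)
      show "gauge (\<lambda>x. ball x (d x))"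
        using d(1) gauge_ball_dependent by blast
    next
      fix p assume "p tagged_division_of {a..b} \<and> (\<lambda>x. ball x (d x)) fine p"
      then have p: "p tagged_division_of {a..b}" and fine: "(\<lambda>x. ball x (d x)) fine p" by auto
      have "finite p" using p by (rule tagged_division_of_finite)
      have pK: "\<exists>u v. K = {u..v} \<and> u \<le> x \<and> x \<le> v \<and> a \<le> u \<and> v \<le> b \<and> {u..v} \<subseteq> ball x (d x)"
        if xK: "(x, K) \<in> p" for x K
      proof -
        obtain u v where K: "K = {u..v}"
          using tagged_division_ofD(4)[OF p xK] by auto
        have "x \<in> K" "K \<subseteq> {a..b}" using tagged_division_ofD(2,3)[OF p xK] by auto
        moreover have "K \<subseteq> ball x (d x)" using fine xK by (auto simp: fine_def)
        ultimately show ?thesis unfolding K by (intro exI[of _ u] exI[of _ v]) auto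
      qed
      define h where "h = (\<lambda>(x, K). measure lborel K * f x - (g (Sup K) - g (Inf K)))"
      \<comment> \<open>Degenerate intervals are put on the good side: the definition of absolute continuity
        speaks of intervals with \<open>a < b\<close> only.\<close>
      define pN where "pN = {(x, K) \<in> p. x \<in> N \<and> measure lborel K \<noteq> 0}"
      have "pN \<subseteq> p" by (auto simp: pN_def)
      have sum_g: "g b - g a = (\<Sum>(x, K)\<in>p. g (Sup K) - g (Inf K))"
        using additive_tagged_division_1[OF \<open>a \<le> b\<close> p, of g] by simp
      have sum_id: "b - a = (\<Sum>(x, K)\<in>p. Sup K - Inf K)"
        using additive_tagged_division_1[OF \<open>a \<le> b\<close> p, of "\<lambda>x. x"] by simp
      have good: "norm (h z) \<le> e * (case z of (x, K) \<Rightarrow> Sup K - Inf K)" if zp: "z \<in> p - pN" for z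
      proof -
        obtain x K where z: "z = (x, K)" by (cases z)
        from pK[of x K] zp z obtain u v where K: "K = {u..v}" "u \<le> x" "x \<le> v" "a \<le> u" "v \<le> b"
          "{u..v} \<subseteq> ball x (d x)" by auto
        show ?thesis
        proof (cases "x \<in> N")
          case True
          then have "measure lborel K = 0" using zp z by (auto simp: pN_def)
          then have "u = v" using K by auto
          then show ?thesis using K z by (simp add: h_def)
        next
          case False
          have xab: "x \<in> {a..b} - N" using False K by auto
          have "u \<in> ball x (d x)" "v \<in> ball x (d x)"
            using K(6)[THEN subsetD, of u] K(6)[THEN subsetD, of v] K(2,3) by auto
          then have "norm (u - x) < d x" "norm (v - x) < d x"
            by (auto simp: dist_real_def)
          then have "\<bar>g u - g x - (u - x) * g' x\<bar> \<le> e * (x - u)"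
            "\<bar>g v - g x - (v - x) * g' x\<bar> \<le> e * (v - x)"
            using d(3)[OF xab, of u] d(3)[OF xab, of v] K(2,3) by auto
          moreover have "(v - u) * g' x - (g v - g u) =
              (g u - g x - (u - x) * g' x) - (g v - g x - (v - x) * g' x)"
            by (simp add: algebra_simps)
          ultimately have "\<bar>(v - u) * g' x - (g v - g u)\<bar> \<le> e * (x - u) + e * (v - x)"
            by linarith
          also have "\<dots> = e * (v - u)" by (simp add: algebra_simps)
          finally show ?thesis
            using False K(1-3) z by (simp add: h_def f_def)
        qed
      qed
      have bad: "(\<Sum>z\<in>pN. norm (h z)) < \<epsilon> / 2"
      proof -
        define I where "I = (\<lambda>(x :: real, K :: real set). (Inf K, Sup K))"
        have pN: "\<exists>u v. K = {u..v} \<and> u < v \<and> u \<le> x \<and> x \<le> v \<and> a \<le> u \<and> v \<le> b \<and> {u..v} \<subseteq> U"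
          if "(x, K) \<in> pN" for x K
        proof -
          have "(x, K) \<in> p" "x \<in> N" "measure lborel K \<noteq> 0" using that by (auto simp: pN_def)
          with pK[of x K] obtain u v where K: "K = {u..v}" "u \<le> x" "x \<le> v" "a \<le> u" "v \<le> b"
            "{u..v} \<subseteq> ball x (d x)" by auto
          moreover have "u < v" using K \<open>measure lborel K \<noteq> 0\<close> by (cases "u = v") auto
          moreover have "{u..v} \<subseteq> U" using K d(2)[OF \<open>x \<in> N\<close>] by blast
          ultimately show ?thesis by blast
        qed
        have disj: "{Inf K<..<Sup K} \<inter> {Inf K'<..<Sup K'} = {}"
          if "(x, K) \<in> pN" "(x', K') \<in> pN" "(x, K) \<noteq> (x', K')" for x K x' K'
        proof -
          have "interior K \<inter> interior K' = {}"
            using p that by (intro tagged_division_ofD(5)[OF p]) (auto simp: pN_def)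
          moreover from pN[OF that(1)] pN[OF that(2)] obtain u v u' v' where
            "K = {u..v}" "u < v" "K' = {u'..v'}" "u' < v'" by blast
          ultimately show ?thesis by simp
        qed
        have "finite pN" using \<open>finite p\<close> \<open>pN \<subseteq> p\<close> by (rule finite_subset[rotated])
        have inj: "inj_on I pN"
        proof (rule inj_onI, rule ccontr)
          fix z z' assume z: "z \<in> pN" "z' \<in> pN" "I z = I z'" "z \<noteq> z'"
          obtain x K x' K' where zz: "z = (x, K)" "z' = (x', K')" by (cases z, cases z') auto
          have "{Inf K<..<Sup K} = {}" using disj[of x K x' K'] z zz by (simp add: I_def)
          moreover from pN[of x K] z zz have "Inf K < Sup K" by auto
          ultimately show False by simp
        qed
        have dfam: "disjoint_family_on (\<lambda>(u, v). {u<..<v}) (I ` pN)"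
          unfolding disjoint_family_on_def
        proof (intro ballI impI)
          fix m m' assume "m \<in> I ` pN" "m' \<in> I ` pN" "m \<noteq> m'"
          then obtain x K x' K' where "(x, K) \<in> pN" "(x', K') \<in> pN" "m = (Inf K, Sup K)"
            "m' = (Inf K', Sup K')" "(x, K) \<noteq> (x', K')" by (auto simp: I_def)
          then show "(case m of (u, v) \<Rightarrow> {u<..<v}) \<inter> (case m' of (u, v) \<Rightarrow> {u<..<v}) = {}"
            using disj by simp
        qed
        have sub: "\<forall>(u, v)\<in>I ` pN. u < v \<and> {u..v} \<subseteq> {a..b}"
        proof -
          have "Inf K < Sup K \<and> {Inf K..Sup K} \<subseteq> {a..b}" if "(x, K) \<in> pN" for x K
            using pN[OF that] by auto
          then show ?thesis by (auto simp: I_def)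
        qed
        have "ennreal (\<Sum>(u, v)\<in>I ` pN. v - u) = (\<Sum>(u, v)\<in>I ` pN. emeasure lborel {u<..<v})"
        proof -
          have "(\<Sum>(u, v)\<in>I ` pN. emeasure lborel {u<..<v}) = (\<Sum>(u, v)\<in>I ` pN. ennreal (v - u))"
            using sub by (intro sum.cong) auto
          also have "\<dots> = ennreal (\<Sum>(u, v)\<in>I ` pN. v - u)"
            using sub by (subst sum_ennreal[symmetric]) (auto simp: case_prod_unfold less_imp_le)
          finally show ?thesis by simp
        qed
        also have "\<dots> = emeasure lborel (\<Union>(u, v)\<in>I ` pN. {u<..<v})"
          using dfam \<open>finite pN\<close> sum_emeasure[of "\<lambda>(u, v). {u<..<v}" "I ` pN" lborel]
          by (simp add: case_prod_unfold image_subset_iff)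
        also have "\<dots> = emeasure lebesgue (\<Union>(u, v)\<in>I ` pN. {u<..<v})"
        proof -
          have "open (\<Union>(u, v)\<in>I ` pN. {u<..<v})"
            by (intro open_UN) (auto simp: case_prod_unfold)
          then have "(\<Union>(u, v)\<in>I ` pN. {u<..<v}) \<in> sets lborel" by simp
          then show ?thesis by simp
        qed
        also have "\<dots> \<le> emeasure lebesgue U"
        proof (rule emeasure_mono)
          have "{Inf K<..<Sup K} \<subseteq> U" if "(x, K) \<in> pN" for x K
          proof -
            from pN[OF that] obtain u v where "K = {u..v}" "u < v" "{u..v} \<subseteq> U" by blast
            then show ?thesis by (auto simp: subset_iff)
          qed
          then show "(\<Union>(u, v)\<in>I ` pN. {u<..<v}) \<subseteq> U" by (auto simp: I_def)
          show "U \<in> sets lebesgue"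
            using borel_open[OF U(1)] by (simp add: sets_completionI_sets)
        qed
        also note emU
        finally have "ennreal (\<Sum>(u, v)\<in>I ` pN. v - u) < ennreal \<delta>" .
        then have "(\<Sum>(u, v)\<in>I ` pN. v - u) < \<delta>"
          using ennreal_leI by (meson not_le)
        with \<delta>[OF _ sub dfam] \<open>finite pN\<close> have "(\<Sum>(u, v)\<in>I ` pN. \<bar>g v - g u\<bar>) < \<epsilon> / 2" by blast
        also have "(\<Sum>(u, v)\<in>I ` pN. \<bar>g v - g u\<bar>) = (\<Sum>z\<in>pN. norm (h z))"
          unfolding sum.reindex[OF inj]
          by (intro sum.cong) (auto simp: I_def h_def f_def pN_def)
        finally show ?thesis .
      qed
      have "(\<Sum>(x, K)\<in>p. measure lborel K *\<^sub>R f x) - (g b - g a) = (\<Sum>z\<in>p. h z)"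
        unfolding sum_g h_def by (simp add: sum_subtractf[symmetric] case_prod_unfold)
      also have "(\<Sum>z\<in>p. h z) = (\<Sum>z\<in>p - pN. h z) + (\<Sum>z\<in>pN. h z)"
        using \<open>finite p\<close> \<open>pN \<subseteq> p\<close> by (intro sum.subset_diff)
      also have "norm \<dots> \<le> (\<Sum>z\<in>p - pN. norm (h z)) + (\<Sum>z\<in>pN. norm (h z))"
        by (intro norm_triangle_mono norm_sum)
      also have "(\<Sum>z\<in>p - pN. norm (h z)) \<le> (\<Sum>z\<in>p - pN. e * (case z of (x, K) \<Rightarrow> Sup K - Inf K))"
        by (intro sum_mono good)
      also have "\<dots> \<le> (\<Sum>z\<in>p. e * (case z of (x, K) \<Rightarrow> Sup K - Inf K))"
      proof (rule sum_mono2[OF \<open>finite p\<close>])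
        fix z assume "z \<in> p - (p - pN)"
        then obtain x K where "z = (x, K)" "(x, K) \<in> p" by (cases z) auto
        with pK[of x K] obtain u v where "z = (x, {u..v})" "u \<le> v" by force
        then show "0 \<le> e * (case z of (x, K) \<Rightarrow> Sup K - Inf K)" using \<open>e > 0\<close> by simp
      qed auto
      also have "\<dots> = e * (b - a)"
        unfolding sum_id by (simp add: sum_distrib_left)
      finally show "norm ((\<Sum>(x, K)\<in>p. measure lborel K *\<^sub>R f x) - (g b - g a)) < \<epsilon>"
        using bad \<open>e * (b - a) < \<epsilon> / 2\<close> by linarith
    qed
  qed
  then show ?thesis
    by (rule has_integral_spike[OF N, rotated]) (simp add: f_def)
qed

section \<open>Admissible paths on a grid\<close>

lemma integral_grid_sum:
  fixes h :: "real \<Rightarrow> real"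
  assumes "h integrable_on {0..1}" "n > 0"
  shows "integral {0..1} h = (\<Sum>i<n. integral {real i / real n..real (Suc i) / real n} h)"
proof -
  have "integral {0..real m / real n} h = (\<Sum>i<m. integral {real i / real n..real (Suc i) / real n} h)"
    if "m \<le> n" for m
    using that
  proof (induction m)
    case (Suc m)
    have "h integrable_on {0..real (Suc m) / real n}"
      using Suc.prems assms by (intro integrable_on_subinterval[OF assms(1)]) (auto simp: divide_simps)
    then have "integral {0..real m / real n} h + integral {real m / real n..real (Suc m) / real n} h =
        integral {0..real (Suc m) / real n} h"
      using assms(2) by (intro Henstock_Kurzweil_Integration.integral_combine) (auto simp: divide_simps)
    with Suc show ?case by simp
  qed simp
  from this[of n] assms show ?thesis by simp
qed

lemma grid_interval_subset:
  assumes "i < n"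
  shows "{real i / real n..real (Suc i) / real n} \<subseteq> {0..1}"
    and "real i / real n \<le> real (Suc i) / real n"
    and "real (Suc i) / real n - real i / real n = 1 / real n"
  using assms by (auto simp: divide_simps)

definition path_functional :: "real \<Rightarrow> real \<Rightarrow> nat \<Rightarrow> (real \<Rightarrow> real) \<Rightarrow> real" where
  "path_functional \<rho> \<beta> q g = g 1 * ln \<rho>
     + \<beta> * (LINT x:{0..1}|lebesgue. (g 1 - g x)\<^sup>2)
     - real q * (LINT x:{0..1}|lebesgue. entropy_function (deriv g x / real q))"

text \<open>Working with \<open>f\<close> instead of \<open>deriv g\<close> makes the bounds valid everywhere, not just almost
  everywhere, and fixes a value where \<open>g\<close> is not differentiable.\<close>
lemma admissible_path_density:
  assumes "g \<in> admissible_paths q"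
  obtains f N where "negligible N" "\<And>x. x \<in> {0..1} - N \<Longrightarrow> f x = deriv g x"
    "\<And>x. 0 \<le> f x" "\<And>x. f x \<le> real q" "f absolutely_integrable_on {0..1}"
    "\<And>a b. 0 \<le> a \<Longrightarrow> a \<le> b \<Longrightarrow> b \<le> 1 \<Longrightarrow> (f has_integral (g b - g a)) {a..b}"
proof -
  from assms have ac: "absolutely_continuous_fun_on {0..1} g"
    and "AE x in lebesgue_on {0..1}. g differentiable (at x) \<and> 0 \<le> deriv g x \<and> deriv g x \<le> real q"
    by (auto simp: admissible_paths_def)
  then have "AE x in lebesgue. x \<in> {0..1} \<longrightarrow> g differentiable (at x) \<and> 0 \<le> deriv g x \<and> deriv g x \<le> real q"
    by (subst (asm) AE_restrict_space_iff) auto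
  then obtain N where N: "N \<in> null_sets lebesgue"
    and der: "\<And>x. x \<in> {0..1} - N \<Longrightarrow> g differentiable (at x) \<and> 0 \<le> deriv g x \<and> deriv g x \<le> real q"
    by (rule AE_E3) auto
  define f where "f x = (if x \<in> {0..1} - N then deriv g x else 0)" for x
  have neg: "negligible N" using N by (simp add: negligible_iff_null_sets)
  have f: "(f has_integral (g b - g a)) {a..b}" if "0 \<le> a" "a \<le> b" "b \<le> 1" for a b
  proof (rule absolutely_continuous_has_integral_derivative[OF \<open>a \<le> b\<close> _ neg])
    show "absolutely_continuous_fun_on {a..b} g"
      using that by (intro absolutely_continuous_fun_on_subset[OF ac]) auto
    fix x assume "x \<in> {a..b} - N"
    then have x: "x \<in> {0..1} - N" using that by auto
    then show "(g has_real_derivative f x) (at x)"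
      using der[OF x] by (simp add: f_def DERIV_deriv_iff_real_differentiable)
  qed
  have bounds: "0 \<le> f x" "f x \<le> real q" for x
    using der by (auto simp: f_def)
  have "f absolutely_integrable_on {0..1}"
    using f[of 0 1] bounds by (intro nonnegative_absolutely_integrable_1) auto
  then show thesis
    using that[of N f] neg bounds f by (auto simp: f_def)
qed

lemma admissible_path_increment:
  assumes "g \<in> admissible_paths q" "0 \<le> a" "a \<le> b" "b \<le> 1"
  shows "0 \<le> g b - g a" "g b - g a \<le> real q * (b - a)"
proof -
  from admissible_path_density[OF assms(1)] obtain f where f: "\<And>x. 0 \<le> f x" "\<And>x. f x \<le> real q"
    "(f has_integral (g b - g a)) {a..b}" using assms(2-) by metis
  from f show "0 \<le> g b - g a" by (intro has_integral_nonneg[OF f(3)]) auto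
  have "((\<lambda>_. real q) has_integral real q * (b - a)) {a..b}"
    using has_integral_const_real[of "real q" a b] assms by (simp add: mult.commute)
  then show "g b - g a \<le> real q * (b - a)"
    using f by (intro has_integral_le[OF f(3)]) auto
qed

lemma admissible_path_continuous:
  assumes "g \<in> admissible_paths q"
  shows "continuous_on {0..1} g"
proof -
  have "\<bar>g y - g x\<bar> \<le> real q * \<bar>y - x\<bar>" if "x \<in> {0..1}" "y \<in> {0..1}" for x y
    using admissible_path_increment[OF assms, of x y] admissible_path_increment[OF assms, of y x] that
    by (cases "x \<le> y") (auto simp: abs_if)
  then have "(real q)-lipschitz_on {0..1} g"
    by (intro lipschitz_onI) (auto simp: dist_real_def abs_minus_commute)
  then show ?thesis
    by (rule lipschitz_on_continuous_on)
qed

lemma absolutely_integrable_path_square: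
  assumes "g \<in> admissible_paths q"
  shows "(\<lambda>x. (g 1 - g x)\<^sup>2) absolutely_integrable_on {0..1}"
  by (intro absolutely_integrable_continuous_real continuous_intros admissible_path_continuous[OF assms])

lemma absolutely_integrable_entropy_density:
  fixes f :: "real \<Rightarrow> real"
  assumes "f absolutely_integrable_on {0..1}" "\<And>x. 0 \<le> f x" "\<And>x. f x \<le> real q" "q > 0"
  shows "(\<lambda>x. entropy_function (f x / real q)) absolutely_integrable_on {0..1}"
proof (rule measurable_bounded_by_integrable_imp_absolutely_integrable)
  have [measurable]: "f \<in> borel_measurable (lebesgue_on {0..1})"
    using assms(1) by (rule absolutely_integrable_imp_borel_measurable) simp
  show "(\<lambda>x. entropy_function (f x / real q)) \<in> borel_measurable (lebesgue_on {0..1})"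
    by measurable
  show "(\<lambda>_. ln 2) integrable_on {0..1::real}" by (rule integrable_const_ivl)
  fix x :: real
  have "0 \<le> f x / real q" "f x / real q \<le> 1" using assms by auto
  from entropy_function_bounds[OF this] show "norm (entropy_function (f x / real q)) \<le> ln 2" by simp
qed auto

lemma absolutely_integrable_entropy_deriv:
  assumes "g \<in> admissible_paths q" "q > 0"
  shows "(\<lambda>x. entropy_function (deriv g x / real q)) absolutely_integrable_on {0..1}"
proof -
  from admissible_path_density[OF assms(1)] obtain f N where f: "negligible N"
    "\<And>x. x \<in> {0..1} - N \<Longrightarrow> f x = deriv g x" "\<And>x. 0 \<le> f x" "\<And>x. f x \<le> real q"
    "f absolutely_integrable_on {0..1}" by metis
  show ?thesis
    by (rule absolutely_integrable_spike[OF absolutely_integrable_entropy_density[OF f(5,3,4)] f(1)])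
      (use assms f(2) in auto)
qed

lemma path_functional_eq:
  assumes "g \<in> admissible_paths q" "q > 0"
  shows "path_functional \<rho> \<beta> q g = g 1 * ln \<rho>
     + \<beta> * integral {0..1} (\<lambda>x. (g 1 - g x)\<^sup>2)
     - real q * integral {0..1} (\<lambda>x. entropy_function (deriv g x / real q))"
  unfolding path_functional_def
  by (simp add: set_lebesgue_integral_eq_integral(2) absolutely_integrable_path_square[OF assms(1)]
      absolutely_integrable_entropy_deriv[OF assms])

text \<open>The integrand is nonincreasing on \<open>{0..1}\<close>, so a Riemann sum over left end points dominates the
  integral. Its term at \<open>0\<close> is estimated by \<open>q\<^sup>2\<close>; the others match
  the squares in the energy, whose index starts at \<open>1\<close>.\<close>
lemma path_square_integral_le:
  assumes g: "g \<in> admissible_paths q" and "n > 0"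
  shows "real n * integral {0..1} (\<lambda>x. (g 1 - g x)\<^sup>2) \<le> (real q)\<^sup>2 + (\<Sum>m=1..<n. (g 1 - g (real m / real n))\<^sup>2)"
proof -
  let ?h = "\<lambda>x. (g 1 - g x)\<^sup>2"
  have int: "?h integrable_on {0..1}"
    using absolutely_integrable_path_square[OF g] by (rule set_lebesgue_integral_eq_integral(1))
  have "integral {real i / real n..real (Suc i) / real n} ?h \<le> 1 / real n * ?h (real i / real n)"
    if "i < n" for i
  proof -
    note J = grid_interval_subset[OF that]
    have "integral {real i / real n..real (Suc i) / real n} ?h \<le>
        integral {real i / real n..real (Suc i) / real n} (\<lambda>_. ?h (real i / real n))"
    proof (rule integral_le)
      show "?h integrable_on {real i / real n..real (Suc i) / real n}"
        using J by (intro integrable_on_subinterval[OF int]) auto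
      fix x assume x: "x \<in> {real i / real n..real (Suc i) / real n}"
      then have "x \<le> 1" "0 \<le> x" using subsetD[OF J(1) x] by auto
      have "0 \<le> real i / real n" by simp
      then have "g (real i / real n) \<le> g x" "g x \<le> g 1"
        using admissible_path_increment(1)[OF g, of "real i / real n" x]
          admissible_path_increment(1)[OF g, of x 1] x \<open>x \<le> 1\<close> \<open>0 \<le> x\<close> by auto
      then show "?h x \<le> ?h (real i / real n)" by (intro power_mono) auto
    qed auto
    also have "\<dots> = 1 / real n * ?h (real i / real n)"
      using J by simp
    finally show ?thesis .
  qed
  then have "integral {0..1} ?h \<le> (\<Sum>i<n. 1 / real n * ?h (real i / real n))"
    unfolding integral_grid_sum[OF int \<open>n > 0\<close>] by (intro sum_mono) auto
  then have "real n * integral {0..1} ?h \<le> (\<Sum>i<n. ?h (real i / real n))"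
    using \<open>n > 0\<close> by (simp add: sum_divide_distrib[symmetric] field_simps)
  also have "\<dots> = ?h 0 + (\<Sum>m=1..<n. ?h (real m / real n))"
    using \<open>n > 0\<close> by (simp add: lessThan_atLeast0 sum.atLeast_Suc_lessThan)
  also have "?h 0 \<le> (real q)\<^sup>2"
    using admissible_path_increment[OF g, of 0 1] by (intro power_mono) auto
  finally show ?thesis by simp
qed

lemma linearised_energy_eq:
  assumes "\<rho> > 0"
  shows "linearised_energy \<rho> q n \<kappa> c =
    (\<Sum>i<n. real q * ln (1 + exp (ln \<rho> + 2 * \<kappa> * (\<Sum>m=1..i. c m)))) - \<kappa> * (\<Sum>m=1..<n. (c m)\<^sup>2)"
  using assms by (simp add: linearised_energy_def exp_add)

lemma sum_mult_tilt:
  fixes p c :: "nat \<Rightarrow> real"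
  shows "(\<Sum>i<n. p i * (a + b * (\<Sum>m=1..i. c m))) = a * (\<Sum>i<n. p i) + b * (\<Sum>m=1..<n. c m * tail_sum n p m)"
proof -
  have "(\<Sum>i<n. p i * (a + b * (\<Sum>m=1..i. c m))) =
      a * (\<Sum>i<n. p i) + b * (\<Sum>i<n. p i * (\<Sum>m=1..i. c m))"
    by (simp add: sum.distrib sum_distrib_left algebra_simps)
  then show ?thesis by (simp only: sum_mult_partial_sums)
qed

text \<open>The tangent points are the scaled values of the path itself, so that the linearised energy at
  the increments of \<open>g\<close> reproduces the quadratic one: \<open>2 * c * T - c\<^sup>2 = T\<^sup>2\<close> for \<open>T = c\<close>. On each
  grid interval the duality inequality at \<open>y = f x / q\<close> is integrated; as the dual variable \<open>r i\<close> is
  constant there, \<open>f\<close> enters only through its integral, the increment \<open>\<Delta> i\<close> of \<open>g\<close>.\<close>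
lemma path_functional_le_linearised_energy:
  assumes g: "g \<in> admissible_paths q" and "q > 0" "\<rho> > 0" "\<beta> \<ge> 0" "n > 0"
  shows "\<exists>c. real n * path_functional \<rho> \<beta> q g - \<beta> * (real q)\<^sup>2 \<le> linearised_energy \<rho> q n (\<beta> / (real n)\<^sup>2) c"
proof -
  from admissible_path_density[OF g] obtain f N where f: "negligible N"
    "\<And>x. x \<in> {0..1} - N \<Longrightarrow> f x = deriv g x" "\<And>x. 0 \<le> f x" "\<And>x. f x \<le> real q"
    "f absolutely_integrable_on {0..1}"
    "\<And>a b. 0 \<le> a \<Longrightarrow> a \<le> b \<Longrightarrow> b \<le> 1 \<Longrightarrow> (f has_integral (g b - g a)) {a..b}" by metis
  define \<kappa> where "\<kappa> = \<beta> / (real n)\<^sup>2"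
  define G where "G m = g 1 - g (real m / real n)" for m
  define c where "c m = real n * G m" for m
  define r where "r i = ln \<rho> + 2 * \<kappa> * (\<Sum>m=1..i. c m)" for i
  define \<Delta> where "\<Delta> i = g (real (Suc i) / real n) - g (real i / real n)" for i
  define H where "H x = entropy_function (f x / real q)" for x
  have H: "H integrable_on {0..1}"
    unfolding H_def
    using absolutely_integrable_entropy_density[OF f(5,3,4)] \<open>q > 0\<close>
    by (intro set_lebesgue_integral_eq_integral(1)) auto
  have H_eq: "integral {0..1} H = integral {0..1} (\<lambda>x. entropy_function (deriv g x / real q))"
    unfolding H_def by (rule integral_spike[OF f(1)]) (use f(2) in auto)
  have block: "\<Delta> i * r i - real q * integral {real i / real n..real (Suc i) / real n} H
      \<le> real q * ln (1 + exp (r i)) / real n" if "i < n" for i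
  proof -
    note J = grid_interval_subset[OF that]
    let ?J = "{real i / real n..real (Suc i) / real n}"
    have "(f has_integral \<Delta> i) ?J"
      unfolding \<Delta>_def using J by (intro f) auto
    moreover have "(H has_integral integral ?J H) ?J"
      using J by (intro integrable_integral integrable_on_subinterval[OF H]) auto
    ultimately have "((\<lambda>x. f x * r i - real q * H x) has_integral (\<Delta> i * r i - real q * integral ?J H)) ?J"
      by (intro has_integral_diff has_integral_mult_left has_integral_mult_right)
    moreover have "((\<lambda>_. real q * ln (1 + exp (r i))) has_integral real q * ln (1 + exp (r i)) / real n) ?J"
      using has_integral_const_real[of "real q * ln (1 + exp (r i))" "real i / real n" "real (Suc i) / real n"] J
      by simp
    ultimately show ?thesis
    proof (rule has_integral_le)
      fix x
      have "f x / real q * r i - H x \<le> ln (1 + exp (r i))"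
        unfolding H_def using f(3)[of x] f(4)[of x] \<open>q > 0\<close> by (intro fenchel_young_entropy) auto
      from mult_left_mono[OF this, of "real q"] show "f x * r i - real q * H x \<le> real q * ln (1 + exp (r i))"
        using \<open>q > 0\<close> by (simp add: algebra_simps)
    qed
  qed
  have tail: "tail_sum n \<Delta> m = G m" if "m \<le> n" for m
    using sum_Suc_diff'[OF that, of "\<lambda>i. g (real i / real n)"] \<open>n > 0\<close>
    by (simp add: tail_sum_def \<Delta>_def G_def)
  have "(\<Sum>i<n. \<Delta> i) = g 1"
    using tail[of 0] g by (simp add: tail_sum_def G_def lessThan_atLeast0 admissible_paths_def)
  have "(\<Sum>i<n. \<Delta> i * r i) = ln \<rho> * g 1 + 2 * \<kappa> * (\<Sum>m=1..<n. c m * tail_sum n \<Delta> m)"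
    unfolding r_def sum_mult_tilt \<open>(\<Sum>i<n. \<Delta> i) = g 1\<close> ..
  also have "(\<Sum>m=1..<n. c m * tail_sum n \<Delta> m) = real n * (\<Sum>m=1..<n. (G m)\<^sup>2)"
    by (simp add: tail c_def power2_eq_square sum_distrib_left mult_ac)
  finally have D: "(\<Sum>i<n. \<Delta> i * r i) = ln \<rho> * g 1 + 2 * \<kappa> * (real n * (\<Sum>m=1..<n. (G m)\<^sup>2))" .
  have nn: "\<kappa> * (real n)\<^sup>2 = \<beta>" using \<open>n > 0\<close> by (simp add: \<kappa>_def)
  have "(\<Sum>i<n. \<Delta> i * r i) - real q * integral {0..1} H =
      (\<Sum>i<n. \<Delta> i * r i - real q * integral {real i / real n..real (Suc i) / real n} H)"
    unfolding integral_grid_sum[OF H \<open>n > 0\<close>] by (simp add: sum_subtractf sum_distrib_left)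
  also have "\<dots> \<le> (\<Sum>i<n. real q * ln (1 + exp (r i)) / real n)"
    by (intro sum_mono block) auto
  finally have "real n * ((\<Sum>i<n. \<Delta> i * r i) - real q * integral {0..1} H) \<le> (\<Sum>i<n. real q * ln (1 + exp (r i)))"
    using \<open>n > 0\<close> by (simp add: sum_divide_distrib[symmetric] field_simps)
  moreover have "linearised_energy \<rho> q n \<kappa> c = (\<Sum>i<n. real q * ln (1 + exp (r i))) - \<kappa> * (\<Sum>m=1..<n. (c m)\<^sup>2)"
    unfolding r_def by (rule linearised_energy_eq) fact
  moreover have "\<kappa> * (\<Sum>m=1..<n. (c m)\<^sup>2) = \<beta> * (\<Sum>m=1..<n. (G m)\<^sup>2)"
    unfolding c_def nn[symmetric] by (simp add: power_mult_distrib sum_distrib_left mult_ac)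
  moreover have "real n * (\<Sum>i<n. \<Delta> i * r i) = real n * ln \<rho> * g 1 + 2 * \<beta> * (\<Sum>m=1..<n. (G m)\<^sup>2)"
    unfolding D nn[symmetric] by (simp add: power2_eq_square algebra_simps)
  moreover have "\<beta> * (real n * integral {0..1} (\<lambda>x. (g 1 - g x)\<^sup>2)) \<le> \<beta> * ((real q)\<^sup>2 + (\<Sum>m=1..<n. (G m)\<^sup>2))"
    unfolding G_def by (intro mult_left_mono path_square_integral_le[OF g \<open>n > 0\<close>]) fact
  ultimately have "real n * path_functional \<rho> \<beta> q g - \<beta> * (real q)\<^sup>2 \<le> linearised_energy \<rho> q n \<kappa> c"
    unfolding path_functional_eq[OF g \<open>q > 0\<close>] H_eq[symmetric] by (simp add: algebra_simps)
  then show ?thesis unfolding \<kappa>_def by blast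
qed

section \<open>Polygonal paths\<close>

text \<open>The path with slope \<open>p i\<close> on the \<open>i\<close>-th grid interval, as a sum of ramps of height \<open>1 / n\<close>. In
  this form monotonicity and Lipschitz bounds are immediate.\<close>
definition polygonal_path :: "nat \<Rightarrow> (nat \<Rightarrow> real) \<Rightarrow> real \<Rightarrow> real" where
  "polygonal_path n p x = (\<Sum>i<n. p i * min (1 / real n) (max 0 (x - real i / real n)))"

lemma polygonal_path_on_grid_interval:
  assumes "n > 0" "j < n" "real j / real n \<le> x" "x \<le> real (Suc j) / real n"
  shows "polygonal_path n p x = (\<Sum>i<j. p i) / real n + p j * (x - real j / real n)"
proof -
  have below: "min (1 / real n) (max 0 (x - real i / real n)) = 1 / real n" if "i < j" for i
  proof -
    have "real (Suc i) / real n \<le> real j / real n"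
      using that by (intro divide_right_mono) auto
    then have "1 / real n \<le> x - real i / real n" using assms by (simp add: add_divide_distrib)
    then show ?thesis by simp
  qed
  have above: "min (1 / real n) (max 0 (x - real i / real n)) = 0" if "i \<in> {Suc j..<n}" for i
  proof -
    have "real (Suc j) / real n \<le> real i / real n"
      using that by (intro divide_right_mono) auto
    then show ?thesis using assms by simp
  qed
  have at: "min (1 / real n) (max 0 (x - real j / real n)) = x - real j / real n"
    using assms by (simp add: add_divide_distrib)
  have "{..<n} = {..<j} \<union> {j} \<union> {Suc j..<n}" using assms by auto
  then have "polygonal_path n p x = (\<Sum>i\<in>{..<j} \<union> {j} \<union> {Suc j..<n}. p i * min (1 / real n) (max 0 (x - real i / real n)))"
    by (simp only: polygonal_path_def)
  also have "\<dots> = (\<Sum>i<j. p i * (1 / real n)) + p j * (x - real j / real n)"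
    by (subst sum.union_disjoint, simp, simp, fastforce)+ (simp add: below above at)
  finally show ?thesis by (simp add: sum_divide_distrib)
qed

lemma polygonal_path_grid:
  assumes "n > 0" "j \<le> n"
  shows "polygonal_path n p (real j / real n) = (\<Sum>i<j. p i) / real n"
proof (cases "j = n")
  case False
  with assms show ?thesis
    by (subst polygonal_path_on_grid_interval[of n j]) (auto simp: divide_right_mono)
next
  case True
  then obtain m where "n = Suc m" using assms by (cases n) auto
  then have m: "1 - real m / real n = 1 / real n" "m < n" "real m / real n \<le> 1" "real (Suc m) / real n = 1"
    by (auto simp: divide_simps)
  have "polygonal_path n p 1 = (\<Sum>i<m. p i) / real n + p m * (1 - real m / real n)"
    using m assms by (intro polygonal_path_on_grid_interval) auto
  also have "\<dots> = (\<Sum>i<Suc m. p i) / real n"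
    unfolding m(1) by (simp add: add_divide_distrib)
  also have "(\<Sum>i<Suc m. p i) = (\<Sum>i<j. p i)" using True \<open>n = Suc m\<close> by (simp only:)
  finally show ?thesis
    using True assms by simp
qed

lemma polygonal_path_has_derivative:
  assumes "n > 0" "j < n" "real j / real n < x" "x < real (Suc j) / real n"
  shows "(polygonal_path n p has_real_derivative p j) (at x)"
proof (rule has_field_derivative_transform_within_open)
  show "((\<lambda>x. (\<Sum>i<j. p i) / real n + p j * (x - real j / real n)) has_real_derivative p j) (at x)"
    by (auto intro!: derivative_eq_intros)
  show "x \<in> {real j / real n<..<real (Suc j) / real n}" using assms by simp
  fix y assume "y \<in> {real j / real n<..<real (Suc j) / real n}"
  then show "(\<Sum>i<j. p i) / real n + p j * (y - real j / real n) = polygonal_path n p y"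
    using assms by (intro polygonal_path_on_grid_interval[symmetric]) auto
qed simp

lemma off_grid_in_grid_interval:
  assumes "x \<in> {0..1} - (\<lambda>j. real j / real n) ` {..n}" "n > 0"
  shows "\<exists>j<n. real j / real n < x \<and> x < real (Suc j) / real n"
proof -
  have x: "0 \<le> x" "x \<le> 1" using assms(1) by auto
  have off: "x \<noteq> real i / real n" if "i \<le> n" for i
  proof
    assume "x = real i / real n"
    then have "x \<in> (\<lambda>j. real j / real n) ` {..n}"
      using that by (intro image_eqI[of _ _ i]) simp_all
    then show False using assms(1) by simp
  qed
  define j where "j = nat \<lfloor>real n * x\<rfloor>"
  have "0 \<le> real n * x" using x(1) by simp
  then have j: "real j \<le> real n * x" "real n * x < real j + 1"
    unfolding j_def by linarith+
  have "x \<noteq> 1" using off[of n] assms(2) by simp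
  then have "real n * x < real n" using x assms(2) by simp
  then have "j < n" using j by linarith
  have "real j / real n \<le> x" using j(1) assms(2) by (simp add: pos_divide_le_eq mult.commute)
  then have "real j / real n < x" using off[of j] \<open>j < n\<close> by linarith
  moreover have "x < real (Suc j) / real n"
    using j(2) assms(2) by (simp add: pos_less_divide_eq mult.commute)
  ultimately show ?thesis using \<open>j < n\<close> by blast
qed

lemma polygonal_path_admissible:
  assumes "n > 0" and p: "\<And>i. i < n \<Longrightarrow> 0 \<le> p i \<and> p i \<le> real q"
  shows "polygonal_path n p \<in> admissible_paths q"
proof -
  define \<phi> where "\<phi> i x = min (1 / real n) (max 0 (x - real i / real n))" for i and x :: real
  have path: "polygonal_path n p x = (\<Sum>i<n. p i * \<phi> i x)" for x
    by (simp add: polygonal_path_def \<phi>_def)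
  have \<phi>: "0 \<le> \<phi> i x" "\<phi> i x \<le> 1 / real n" for i x by (auto simp: \<phi>_def)
  have lip: "\<bar>\<phi> i y - \<phi> i x\<bar> \<le> \<bar>y - x\<bar>" for i x y by (auto simp: \<phi>_def min_def max_def)
  have "\<bar>polygonal_path n p y - polygonal_path n p x\<bar> \<le> (real n * real q) * \<bar>y - x\<bar>" for x y
  proof -
    have "\<bar>\<Sum>i<n. p i * (\<phi> i y - \<phi> i x)\<bar> \<le> (\<Sum>i<n. \<bar>p i * (\<phi> i y - \<phi> i x)\<bar>)"
      by (rule sum_abs)
    also have "\<dots> \<le> (\<Sum>i<n. real q * \<bar>y - x\<bar>)"
      unfolding abs_mult using p lip by (intro sum_mono mult_mono) auto
    finally show ?thesis
      by (simp add: path sum_subtractf[symmetric] right_diff_distrib mult.assoc)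
  qed
  then have "absolutely_continuous_fun_on {0..1} (polygonal_path n p)"
    by (rule lipschitz_imp_absolutely_continuous_fun_on)
  moreover have "polygonal_path n p 0 = 0"
    by (simp add: polygonal_path_def)
  moreover have "polygonal_path n p x \<in> {0..real q}" for x
  proof -
    have "polygonal_path n p x \<le> (\<Sum>i<n. real q * (1 / real n))"
      unfolding path using p \<phi> by (intro sum_mono mult_mono) auto
    moreover have "0 \<le> polygonal_path n p x"
      unfolding path using p \<phi> by (intro sum_nonneg mult_nonneg_nonneg) auto
    ultimately show ?thesis using assms by simp
  qed
  moreover have "AE x in lebesgue_on {0..1}. polygonal_path n p differentiable (at x) \<and>
      0 \<le> deriv (polygonal_path n p) x \<and> deriv (polygonal_path n p) x \<le> real q"
  proof -
    let ?P = "\<lambda>x. polygonal_path n p differentiable (at x) \<and>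
      0 \<le> deriv (polygonal_path n p) x \<and> deriv (polygonal_path n p) x \<le> real q"
    have P: "?P x" if "x \<in> {0..1} - (\<lambda>j. real j / real n) ` {..n}" for x
    proof -
      from off_grid_in_grid_interval[OF that assms(1)] obtain j where
        j: "j < n" "real j / real n < x" "x < real (Suc j) / real n" by blast
      from polygonal_path_has_derivative[OF assms(1) this]
      have "(polygonal_path n p has_real_derivative p j) (at x)" .
      then show ?thesis
        using p[OF j(1)] by (auto simp: DERIV_imp_deriv real_differentiable_def)
    qed
    have "AE x in lebesgue. x \<notin> (\<lambda>j. real j / real n) ` {..n}"
      by (intro AE_not_in) (auto simp: negligible_iff_null_sets[symmetric] intro: negligible_finite)
    then have "AE x in lebesgue. x \<in> {0..1} \<longrightarrow> ?P x"
      by eventually_elim (use P in blast)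
    then show ?thesis
      by (subst AE_restrict_space_iff) auto
  qed
  ultimately show ?thesis
    by (auto simp: admissible_paths_def)
qed

lemma polygonal_path_entropy:
  assumes "n > 0" "q > 0" and p: "\<And>i. i < n \<Longrightarrow> 0 \<le> p i \<and> p i \<le> real q"
  shows "real n * integral {0..1} (\<lambda>x. entropy_function (deriv (polygonal_path n p) x / real q)) =
    (\<Sum>i<n. entropy_function (p i / real q))"
proof -
  let ?h = "\<lambda>x. entropy_function (deriv (polygonal_path n p) x / real q)"
  have int: "?h integrable_on {0..1}"
    using absolutely_integrable_entropy_deriv[OF polygonal_path_admissible[OF assms(1) p] assms(2)]
    by (intro set_lebesgue_integral_eq_integral(1)) auto
  have block: "integral {real i / real n..real (Suc i) / real n} ?h = entropy_function (p i / real q) / real n"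
    if "i < n" for i
  proof -
    note J = grid_interval_subset[OF that]
    let ?J = "{real i / real n..real (Suc i) / real n}"
    have "integral ?J ?h = integral ?J (\<lambda>_. entropy_function (p i / real q))"
    proof (rule integral_spike)
      show "negligible {real i / real n, real (Suc i) / real n}" by (rule negligible_finite) simp
      fix x assume "x \<in> ?J - {real i / real n, real (Suc i) / real n}"
      then have "(polygonal_path n p has_real_derivative p i) (at x)"
        using that assms by (intro polygonal_path_has_derivative) auto
      then show "entropy_function (p i / real q) = ?h x" by (simp add: DERIV_imp_deriv)
    qed
    also have "\<dots> = entropy_function (p i / real q) / real n" using J by simp
    finally show ?thesis .
  qed
  have "integral {0..1} ?h = (\<Sum>i<n. entropy_function (p i / real q) / real n)"
    unfolding integral_grid_sum[OF int assms(1)] by (intro sum.cong block) auto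
  then show ?thesis using assms by (simp add: sum_divide_distrib[symmetric])
qed

text \<open>As the integrand is nonincreasing, the Riemann sum over right end points is dominated by the
  integral. The last right end point contributes \<open>0\<close>, which leaves the indices \<open>1..<n\<close>.\<close>
lemma polygonal_path_square:
  assumes "n > 0" and p: "\<And>i. i < n \<Longrightarrow> 0 \<le> p i \<and> p i \<le> real q"
  shows "(\<Sum>m=1..<n. (tail_sum n p m)\<^sup>2) / (real n)\<^sup>2 \<le>
    real n * integral {0..1} (\<lambda>x. (polygonal_path n p 1 - polygonal_path n p x)\<^sup>2)"
proof -
  define g where "g = polygonal_path n p"
  have g: "g \<in> admissible_paths q" unfolding g_def by (rule polygonal_path_admissible[OF assms])
  let ?h = "\<lambda>x. (g 1 - g x)\<^sup>2"
  have int: "?h integrable_on {0..1}"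
    using absolutely_integrable_path_square[OF g] by (rule set_lebesgue_integral_eq_integral(1))
  have tail: "g 1 - g (real m / real n) = tail_sum n p m / real n" if "m \<le> n" for m
  proof -
    have "(\<Sum>i<n. p i) = (\<Sum>i<m. p i) + tail_sum n p m"
      unfolding tail_sum_def lessThan_atLeast0 using that by (intro sum.atLeastLessThan_concat[symmetric]) auto
    then show ?thesis
      using polygonal_path_grid[OF assms(1) that, of p] polygonal_path_grid[OF assms(1) order_refl, of p] assms(1)
      by (simp add: g_def add_divide_distrib)
  qed
  have "1 / real n * (tail_sum n p (Suc i) / real n)\<^sup>2 \<le> integral {real i / real n..real (Suc i) / real n} ?h"
    if "i < n" for i
  proof -
    note J = grid_interval_subset[OF that]
    let ?J = "{real i / real n..real (Suc i) / real n}"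
    have "integral ?J (\<lambda>_. ?h (real (Suc i) / real n)) \<le> integral ?J ?h"
    proof (rule integral_le)
      show "?h integrable_on ?J"
        using J by (intro integrable_on_subinterval[OF int]) auto
      fix x assume x: "x \<in> ?J"
      have "x \<le> 1" "0 \<le> x" using subsetD[OF J(1) x] by auto
      have le1: "real (Suc i) / real n \<le> 1" using that by simp
      have "g x \<le> g (real (Suc i) / real n)" "g (real (Suc i) / real n) \<le> g 1"
        using admissible_path_increment(1)[OF g, of x "real (Suc i) / real n"]
          admissible_path_increment(1)[OF g, of "real (Suc i) / real n" 1] x \<open>0 \<le> x\<close> le1 by auto
      then show "?h (real (Suc i) / real n) \<le> ?h x" by (intro power_mono) auto
    qed auto
    then show ?thesis using J tail[of "Suc i"] that by simp
  qed
  then have "(\<Sum>i<n. 1 / real n * (tail_sum n p (Suc i) / real n)\<^sup>2) \<le> integral {0..1} ?h"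
    unfolding integral_grid_sum[OF int assms(1)] by (intro sum_mono) auto
  then have "(\<Sum>i<n. (tail_sum n p (Suc i) / real n)\<^sup>2) \<le> real n * integral {0..1} ?h"
    using assms(1) by (simp add: sum_divide_distrib[symmetric] field_simps)
  moreover have "(\<Sum>m=1..<n. (tail_sum n p m)\<^sup>2) / (real n)\<^sup>2 \<le> (\<Sum>i<n. (tail_sum n p (Suc i) / real n)\<^sup>2)"
  proof -
    have "(\<Sum>m=1..<n. (tail_sum n p m / real n)\<^sup>2) \<le> (\<Sum>m=Suc 0..<Suc n. (tail_sum n p m / real n)\<^sup>2)"
      by (intro sum_mono2) auto
    also have "\<dots> = (\<Sum>i<n. (tail_sum n p (Suc i) / real n)\<^sup>2)"
      by (simp add: sum.shift_bounds_Suc_ivl lessThan_atLeast0 del: sum.op_ivl_Suc)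
    finally show ?thesis by (simp add: power_divide sum_divide_distrib)
  qed
  ultimately show ?thesis unfolding g_def by linarith
qed

text \<open>The slopes \<open>p i = q * exp (r i) / (1 + exp (r i))\<close> are those for which the duality inequality is
  an equality; they are the mean spins under the tilted product weights with fields \<open>r i\<close>.\<close>
lemma linearised_energy_le_path_functional:
  assumes "q > 0" "\<rho> > 0" "\<beta> \<ge> 0" "n > 0"
  shows "\<exists>g\<in>admissible_paths q. linearised_energy \<rho> q n (\<beta> / (real n)\<^sup>2) c \<le> real n * path_functional \<rho> \<beta> q g"
proof -
  define \<kappa> where "\<kappa> = \<beta> / (real n)\<^sup>2"
  define r where "r i = ln \<rho> + 2 * \<kappa> * (\<Sum>m=1..i. c m)" for i
  define y where "y i = exp (r i) / (1 + exp (r i))" for i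
  define p where "p i = real q * y i" for i
  define T where "T = tail_sum n p"
  define g where "g = polygonal_path n p"
  have "\<kappa> \<ge> 0" using assms by (simp add: \<kappa>_def)
  have y: "0 \<le> y i" "y i \<le> 1" for i
    by (simp_all add: y_def divide_simps add_pos_pos)
  have p: "0 \<le> p i \<and> p i \<le> real q" for i
    using y[of i] by (simp add: p_def mult_left_le)
  have g: "g \<in> admissible_paths q"
    unfolding g_def by (rule polygonal_path_admissible[OF \<open>n > 0\<close> p])
  have eq: "real q * ln (1 + exp (r i)) = p i * r i - real q * entropy_function (p i / real q)" for i
    using fenchel_young_entropy_eq[of "r i"] \<open>q > 0\<close>
    by (simp add: y_def[symmetric] p_def algebra_simps flip: y_def)
  have "linearised_energy \<rho> q n \<kappa> c =
      (\<Sum>i<n. p i * r i) - real q * (\<Sum>i<n. entropy_function (p i / real q)) - \<kappa> * (\<Sum>m=1..<n. (c m)\<^sup>2)"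
    unfolding linearised_energy_eq[OF \<open>\<rho> > 0\<close>] r_def[symmetric] eq
    by (simp add: sum_subtractf sum_distrib_left)
  also have "(\<Sum>i<n. p i * r i) = ln \<rho> * (\<Sum>i<n. p i) + 2 * \<kappa> * (\<Sum>m=1..<n. c m * T m)"
    unfolding r_def sum_mult_tilt T_def ..
  also have "(\<Sum>i<n. p i) = real n * g 1"
    using polygonal_path_grid[OF \<open>n > 0\<close> order_refl, of p] \<open>n > 0\<close> by (simp add: g_def)
  also have "(\<Sum>i<n. entropy_function (p i / real q)) =
      real n * integral {0..1} (\<lambda>x. entropy_function (deriv g x / real q))"
    unfolding g_def by (rule polygonal_path_entropy[OF \<open>n > 0\<close> \<open>q > 0\<close> p, symmetric])
  finally have L: "linearised_energy \<rho> q n \<kappa> c =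
      ln \<rho> * (real n * g 1) + 2 * \<kappa> * (\<Sum>m=1..<n. c m * T m) -
      real q * (real n * integral {0..1} (\<lambda>x. entropy_function (deriv g x / real q))) -
      \<kappa> * (\<Sum>m=1..<n. (c m)\<^sup>2)" .
  have "2 * \<kappa> * (\<Sum>m=1..<n. c m * T m) - \<kappa> * (\<Sum>m=1..<n. (c m)\<^sup>2) =
      \<kappa> * (\<Sum>m=1..<n. 2 * (c m * T m) - (c m)\<^sup>2)"
    by (simp add: sum_subtractf sum_distrib_left[symmetric] right_diff_distrib)
  also have "\<dots> \<le> \<kappa> * (\<Sum>m=1..<n. (T m)\<^sup>2)"
  proof (intro mult_left_mono sum_mono \<open>\<kappa> \<ge> 0\<close>)
    fix m show "2 * (c m * T m) - (c m)\<^sup>2 \<le> (T m)\<^sup>2"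
      using zero_le_power2[of "T m - c m"] by (simp add: power2_eq_square algebra_simps)
  qed
  also have "\<dots> = \<beta> * ((\<Sum>m=1..<n. (T m)\<^sup>2) / (real n)\<^sup>2)" by (simp add: \<kappa>_def)
  also have "\<dots> \<le> \<beta> * (real n * integral {0..1} (\<lambda>x. (g 1 - g x)\<^sup>2))"
    unfolding T_def g_def by (intro mult_left_mono polygonal_path_square[OF \<open>n > 0\<close> p]) fact
  finally have "linearised_energy \<rho> q n \<kappa> c \<le> real n * path_functional \<rho> \<beta> q g"
    unfolding L path_functional_eq[OF g \<open>q > 0\<close>] by (simp add: algebra_simps)
  then show ?thesis using g unfolding \<kappa>_def by blast
qed

section \<open>The variational formula\<close>

lemma admissible_paths_nonempty: "0 < q \<Longrightarrow> admissible_paths q \<noteq> {}"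
  using linearised_energy_le_path_functional[of q 1 0 1] by auto

lemma path_functional_le_ln_partition_function:
  assumes "g \<in> admissible_paths q" "q > 0" "\<rho> > 0" "\<beta> \<ge> 0" "n > 0"
  shows "real n * path_functional \<rho> \<beta> q g - \<beta> * (real q)\<^sup>2 \<le> ln (partition_function \<rho> q n (\<beta> / (real n)\<^sup>2))"
proof -
  from path_functional_le_linearised_energy[OF assms] obtain c where
    c: "real n * path_functional \<rho> \<beta> q g - \<beta> * (real q)\<^sup>2 \<le> linearised_energy \<rho> q n (\<beta> / (real n)\<^sup>2) c" ..
  have "\<beta> / (real n)\<^sup>2 \<ge> 0" using assms by simp
  note * = exp_linearised_energy_le_partition_function[OF \<open>\<rho> > 0\<close> this, of q n c]
    partition_function_pos[OF \<open>\<rho> > 0\<close> this, of q n]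
  then have "linearised_energy \<rho> q n (\<beta> / (real n)\<^sup>2) c \<le> ln (partition_function \<rho> q n (\<beta> / (real n)\<^sup>2))"
    by (simp add: ln_ge_iff)
  with c show ?thesis by linarith
qed

text \<open>The comparison with the partition function of a single site already bounds the functional.\<close>
lemma bdd_above_path_functional:
  assumes "q > 0" "\<rho> > 0" "\<beta> \<ge> 0"
  shows "bdd_above (path_functional \<rho> \<beta> q ` admissible_paths q)"
proof (rule bdd_aboveI2)
  fix g assume "g \<in> admissible_paths q"
  from path_functional_le_ln_partition_function[OF this assms, of 1]
  show "path_functional \<rho> \<beta> q g \<le> ln (partition_function \<rho> q 1 \<beta>) + \<beta> * (real q)\<^sup>2" by simp
qed

text \<open>With blocks of length about \<open>sqrt n\<close> there are about \<open>sqrt n\<close> block values, each of at most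
  \<open>n * q + 1\<close> possible sizes, so the logarithm of the number of tangent vectors is of order
  \<open>sqrt n * ln n\<close>; at the same time the total error of the linearisation, \<open>\<kappa> * n * (q * L)\<^sup>2\<close>, stays
  bounded.\<close>
lemma ln_partition_function_le:
  assumes "q > 0" "\<rho> > 0" "\<beta> \<ge> 0" "n > 0"
    and S: "\<And>g. g \<in> admissible_paths q \<Longrightarrow> path_functional \<rho> \<beta> q g \<le> S"
  shows "ln (partition_function \<rho> q n (\<beta> / (real n)\<^sup>2)) \<le>
    real n * S + (sqrt (real n) + 1) * ln (real n * real q + 1) + 4 * \<beta> * (real q)\<^sup>2"
proof -
  define L where "L = nat \<lceil>sqrt (real n)\<rceil>"
  define \<kappa> where "\<kappa> = \<beta> / (real n)\<^sup>2"
  have "\<kappa> \<ge> 0" using assms by (simp add: \<kappa>_def)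
  have sq: "sqrt (real n) \<ge> 1" using assms by simp
  then have L: "sqrt (real n) \<le> real L" "real L \<le> 2 * sqrt (real n)"
    unfolding L_def by linarith+
  then have "L > 0" using sq by (cases L) auto
  have "linearised_energy \<rho> q n \<kappa> c \<le> real n * S" for c
  proof -
    from linearised_energy_le_path_functional[OF assms(1-4), of c] obtain g where
      "g \<in> admissible_paths q" "linearised_energy \<rho> q n \<kappa> c \<le> real n * path_functional \<rho> \<beta> q g"
      unfolding \<kappa>_def by blast
    with mult_left_mono[OF S, of g "real n"] show ?thesis by simp
  qed
  from partition_function_le[OF \<open>\<rho> > 0\<close> \<open>\<kappa> \<ge> 0\<close> \<open>L > 0\<close> this]
  have "ln (partition_function \<rho> q n \<kappa>) \<le>
      ln (real (n * q + 1) ^ (n div L + 1) * exp (real n * S + \<kappa> * real n * (real q * real L)\<^sup>2))"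
    using partition_function_pos[OF \<open>\<rho> > 0\<close> \<open>\<kappa> \<ge> 0\<close>, of q n] by (intro ln_mono) auto
  also have "\<dots> = real (n div L + 1) * ln (real n * real q + 1)
      + (real n * S + \<kappa> * real n * (real q * real L)\<^sup>2)"
  proof -
    define a where "a = real n * real q + 1"
    have "a > 0" "real (n * q + 1) = a" by (simp_all add: a_def add_nonneg_pos)
    then show ?thesis
      unfolding a_def[symmetric] using \<open>a > 0\<close> less_imp_neq[OF \<open>a > 0\<close>]
      by (simp add: ln_mult ln_realpow del: power_Suc)
  qed
  also have "real (n div L + 1) * ln (real n * real q + 1) \<le> (sqrt (real n) + 1) * ln (real n * real q + 1)"
  proof (rule mult_right_mono)
    have "real (n div L) \<le> real n / real L" by (rule of_nat_div_le_of_nat)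
    also have "\<dots> \<le> real n / sqrt (real n)"
      using L sq \<open>L > 0\<close> \<open>n > 0\<close> by (intro divide_left_mono mult_pos_pos) auto
    also have "\<dots> = sqrt (real n)" by (simp add: real_div_sqrt)
    finally show "real (n div L + 1) \<le> sqrt (real n) + 1" by simp
  qed simp
  also have "\<kappa> * real n * (real q * real L)\<^sup>2 \<le> 4 * \<beta> * (real q)\<^sup>2"
  proof -
    have "(real L)\<^sup>2 \<le> (2 * sqrt (real n))\<^sup>2" using L by (intro power_mono) auto
    then have "(real L)\<^sup>2 \<le> 4 * real n" by (simp add: power_mult_distrib)
    then have "\<kappa> * real n * (real q)\<^sup>2 * (real L)\<^sup>2 \<le> \<kappa> * real n * (real q)\<^sup>2 * (4 * real n)"
      using \<open>\<kappa> \<ge> 0\<close> by (intro mult_left_mono) auto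
    also have "\<dots> = 4 * \<beta> * (real q)\<^sup>2"
      using \<open>n > 0\<close> by (simp add: \<kappa>_def power2_eq_square)
    finally show ?thesis by (simp add: power_mult_distrib mult_ac)
  qed
  finally show ?thesis unfolding \<kappa>_def by simp
qed

theorem theorem25:
  fixes M :: "'a measure" and W :: "real \<Rightarrow> 'a \<Rightarrow> real"
    and \<sigma> \<tau> :: "nat \<Rightarrow> real" and \<rho> \<beta> x0 :: real and q :: nat
  assumes "standard_brownian_motion M W"
    and "\<rho> > 0" and "\<beta> > 0" and "x0 > 0" and "q > 0"
    and "\<And>n. n \<ge> 1 \<Longrightarrow> \<sigma> n > 0"
    and "\<And>n. n \<ge> 1 \<Longrightarrow> \<tau> n > 0"
    and "\<And>n. n \<ge> 1 \<Longrightarrow> 1/2 * (\<sigma> n)\<^sup>2 * \<tau> n * (real n)\<^sup>2 = \<beta>"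
  shows "\<exists>L :: real.
    (\<lambda>n. 1 / real n *
        ln (integral\<^sup>L M (\<lambda>\<omega>. (growth_process W \<rho> (\<sigma> n) (\<tau> n) x0 n \<omega>) ^ q)))
      \<longlonglongrightarrow> L \<and>
    ereal L =
      (SUP g\<in>admissible_paths q.
         ereal (g 1 * ln \<rho>
           + \<beta> * (LINT x:{0..1}|lebesgue. (g 1 - g x)\<^sup>2)
           - real q * (LINT x:{0..1}|lebesgue. entropy_function (deriv g x / real q))))"
proof -
  interpret standard_brownian_motion M W by fact
  define F where "F = path_functional \<rho> \<beta> q"
  define S where "S = (SUP g\<in>admissible_paths q. F g)"
  define E where "E n = expectation (\<lambda>\<omega>. growth_process W \<rho> (\<sigma> n) (\<tau> n) x0 n \<omega> ^ q)" for n
  define Z where "Z n = partition_function \<rho> q n (\<beta> / (real n)\<^sup>2)" for n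
  have bdd: "bdd_above (F ` admissible_paths q)"
    unfolding F_def using assms by (intro bdd_above_path_functional) auto
  have nonempty: "admissible_paths q \<noteq> {}"
    using assms by (intro admissible_paths_nonempty)
  have F_le: "F g \<le> S" if "g \<in> admissible_paths q" for g
    unfolding S_def using that bdd by (rule cSUP_upper)
  have Z_lower: "real n * S - \<beta> * (real q)\<^sup>2 \<le> ln (Z n)" if "n > 0" for n
  proof -
    have "S \<le> (ln (Z n) + \<beta> * (real q)\<^sup>2) / real n"
      unfolding S_def
    proof (rule cSUP_least[OF nonempty])
      fix g assume "g \<in> admissible_paths q"
      from path_functional_le_ln_partition_function[OF this _ _ _ that, of \<rho> \<beta>] assms
      show "F g \<le> (ln (Z n) + \<beta> * (real q)\<^sup>2) / real n"
        using that by (simp add: F_def Z_def pos_le_divide_eq mult.commute)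
    qed
    then show ?thesis using that by (simp add: pos_le_divide_eq mult.commute)
  qed
  have Z_upper: "ln (Z n) \<le> real n * S + (sqrt (real n) + 1) * ln (real n * real q + 1) + 4 * \<beta> * (real q)\<^sup>2"
    if "n > 0" for n
    unfolding Z_def using assms F_le that by (intro ln_partition_function_le) (auto simp: F_def)
  have ln_E: "ln (E n) \<le> real q * ln x0 + ln (Z n)" "- \<beta> * real q + real q * ln x0 + ln (Z n) \<le> ln (E n)"
    if "n > 0" for n
  proof -
    have \<kappa>: "1/2 * (\<sigma> n)\<^sup>2 * \<tau> n = \<beta> / (real n)\<^sup>2"
      using assms(8)[of n] that by (simp add: field_simps)
    have "Z n > 0" unfolding Z_def using assms by (intro partition_function_pos) auto
    have \<tau>: "\<tau> n > 0" using assms(7)[of n] that by simp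
    note bounds = moment_growth_process_bounds[OF \<tau> assms(2,4), where \<sigma>="\<sigma> n" and n=n and q=q, folded E_def, unfolded \<kappa>, folded Z_def]
    have eq: "- (\<beta> / (real n)\<^sup>2) * (real q * (real n)\<^sup>2) = - \<beta> * real q"
      using that by simp
    have lower: "exp (- \<beta> * real q) * (x0 ^ q * Z n) \<le> E n"
      using bounds(1) unfolding eq .
    have pos: "0 < exp (- \<beta> * real q) * (x0 ^ q * Z n)"
      using \<open>Z n > 0\<close> assms by simp
    then have "E n > 0" using lower by linarith
    have "ln (E n) \<le> ln (x0 ^ q * Z n)"
      using bounds(2) \<open>E n > 0\<close> by (intro ln_mono) auto
    also have "\<dots> = real q * ln x0 + ln (Z n)"
      using \<open>Z n > 0\<close> assms by (simp add: ln_mult ln_realpow)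
    finally show "ln (E n) \<le> real q * ln x0 + ln (Z n)" .
    have "- \<beta> * real q + real q * ln x0 + ln (Z n) = ln (exp (- \<beta> * real q) * (x0 ^ q * Z n))"
      using \<open>Z n > 0\<close> assms by (simp add: ln_mult ln_realpow)
    also have "\<dots> \<le> ln (E n)"
      using lower pos by (intro ln_mono) auto
    finally show "- \<beta> * real q + real q * ln x0 + ln (Z n) \<le> ln (E n)" .
  qed
  have "(\<lambda>n. 1 / real n * ln (E n)) \<longlonglongrightarrow> S"
  proof (rule tendsto_sandwich)
    define A where "A = real q * ln x0 - \<beta> * real q - \<beta> * (real q)\<^sup>2"
    define B where "B = real q * ln x0 + 4 * \<beta> * (real q)\<^sup>2"
    have "S + A / real n \<le> 1 / real n * ln (E n)" if "n > 0" for n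
    proof -
      have "real n * S + A \<le> ln (E n)" using Z_lower[OF that] ln_E(2)[OF that] by (simp add: A_def)
      from divide_right_mono[OF this, of "real n"] that show ?thesis
        by (simp add: add_divide_distrib)
    qed
    then show "\<forall>\<^sub>F n in sequentially. S + A / real n \<le> 1 / real n * ln (E n)"
      by (intro eventually_sequentiallyI[of 1]) auto
    have "1 / real n * ln (E n) \<le> S + ((sqrt (real n) + 1) * ln (real n * real q + 1) + B) / real n" if "n > 0" for n
    proof -
      have "ln (E n) \<le> real n * S + ((sqrt (real n) + 1) * ln (real n * real q + 1) + B)"
        using Z_upper[OF that] ln_E(1)[OF that] by (simp add: B_def)
      then show ?thesis using that by (simp add: field_simps)
    qed
    then show "\<forall>\<^sub>F n in sequentially. 1 / real n * ln (E n) \<le>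
        S + ((sqrt (real n) + 1) * ln (real n * real q + 1) + B) / real n"
      by (intro eventually_sequentiallyI[of 1]) auto
    show "(\<lambda>n. S + A / real n) \<longlonglongrightarrow> S" by real_asymp
    have "real q > 0" using assms by simp
    then show "(\<lambda>n. S + ((sqrt (real n) + 1) * ln (real n * real q + 1) + B) / real n) \<longlonglongrightarrow> S"
      by real_asymp
  qed
  moreover have "ereal S = (SUP g\<in>admissible_paths q. ereal (F g))"
  proof (rule SUP_eqI[symmetric])
    fix y assume y: "\<And>g. g \<in> admissible_paths q \<Longrightarrow> ereal (F g) \<le> y"
    show "ereal S \<le> y"
    proof (cases y)
      case (real r)
      with y have "F g \<le> r" if "g \<in> admissible_paths q" for g using that by fastforce
      then have "S \<le> r" unfolding S_def by (rule cSUP_least[OF nonempty])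
      then show ?thesis using real by simp
    next
      case MInf
      with y nonempty show ?thesis by fastforce
    qed simp
  qed (use F_le in simp)
  ultimately show ?thesis
    unfolding E_def F_def path_functional_def by blast
qed

end
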